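(* Fix a field $\mathbb{F}$ and integers $0\le d<m$. Up to simplicial isomorphism, the set $\Sigma^{tb}(m,d)$ of $d$-dimensional simplicial complexes with vertex set $[m]$ having the maximum reduced total Betti number over $\mathbb{F}$ is as follows: (i) If $d\le \left[\frac m2\right]-1$ or $d=m-1$, then $\Sigma^{tb}(m,d)=\big\{\Delta^{[m]}_{(d)}\big\}$. (ii) If $\left[\frac m2\right]\le d\le m-3$, then $\Sigma^{tb}(m,d)=\big\{\Delta^{[m]}_{([m/2]-1)}\langle d\rangle\big\}$. (iii) If $d=m-2$: when $m$ is odd, $\Sigma^{tb}(m,d)=\big\{\Delta^{[m]}_{([m/2]-1)}\langle d\rangle,\ \Delta^{[m]}_{([m/2])}\langle d\rangle\big\}$; when $m$ is even, $\Sigma^{tb}(m,d)=\big\{\Delta^{[m]}_{([m/2]-1)}\langle d\rangle\big\}$.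
   Context: $[m]=\{1,\dots,m\}$, and $[x]$ for a real number $x$ denotes its integer part. A simplicial complex with vertex set $[m]$ is a family of subsets of $[m]$, closed under taking subsets, containing $\varnothing$ and every singleton $\{i\}$, $i\in[m]$. For a simplicial complex $K$, $\widetilde{\beta}_i(K;\mathbb{F})=\dim_{\mathbb{F}}\widetilde H_i(K;\mathbb{F})$, and the reduced total Betti number is $\widetilde{tb}(K)=\sum_i\widetilde\beta_i(K;\mathbb{F})$. $\Sigma(m,d)$ is the set of all $d$-dimensional simplicial complexes with vertex set $[m]$, and $\Sigma^{tb}(m,d)=\{K\in\Sigma(m,d): \widetilde{tb}(K)=\max_{L\in\Sigma(m,d)}\widetilde{tb}(L)\}$. $\Delta^{[m]}$ is the full $(m-1)$-dimensional simplex on $[m]$, and $\Delta^{[m]}_{(k)}$ is its $k$-skeleton (all subsets of $[m]$ of size at most $k+1$). For $0\le k\le d<m$, $\Delta^{[m]}_{(k)}\langle d\rangle$ is the minimal $d$-dimensional subcomplex of $\Delta^{[m]}$ containing $\Delta^{[m]}_{(k)}$, unique up to simplicial isomorphism: it is the union of $\Delta^{[m]}_{(k)}$ with the full simplex on $\{1,\dots,d+1\}$ (so it equals $\Delta^{[m]}_{(d)}$ when $k=d$). *)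

theory Defs
  imports "HOL-Algebra.AbelCoset" "Jordan_Normal_Form.VS_Connect"
begin

section \<open>Simplicial complexes with vertex set \<open>{1..m}\<close>\<close>

definition simplicial_complex_on :: "nat \<Rightarrow> nat set set \<Rightarrow> bool" where
  "simplicial_complex_on m K \<longleftrightarrow>
     K \<subseteq> Pow {1..m} \<and> {} \<in> K \<and> (\<forall>i\<in>{1..m}. {i} \<in> K) \<and>
     (\<forall>\<sigma>\<in>K. \<forall>\<tau>. \<tau> \<subseteq> \<sigma> \<longrightarrow> \<tau> \<in> K)"

text \<open>Dimensions are integers, since the empty simplex has dimension \<open>-1\<close>.\<close>

definition simplex_dim :: "nat set \<Rightarrow> int" where
  "simplex_dim \<sigma> = int (card \<sigma>) - 1"

definition complex_dim :: "nat set set \<Rightarrow> int" where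
  "complex_dim K = Max (simplex_dim ` K)"

definition simplicial_iso :: "nat set set \<Rightarrow> nat set set \<Rightarrow> bool" where
  "simplicial_iso K L \<longleftrightarrow>
     (\<exists>\<phi>. bij_betw \<phi> (\<Union>K) (\<Union>L) \<and> (\<lambda>\<sigma>. \<phi> ` \<sigma>) ` K = L)"

definition full_skeleton :: "nat \<Rightarrow> nat \<Rightarrow> nat set set" where
  "full_skeleton m k = {\<sigma>. \<sigma> \<subseteq> {1..m} \<and> card \<sigma> \<le> k + 1}"

definition skeleton_with_simplex :: "nat \<Rightarrow> nat \<Rightarrow> nat \<Rightarrow> nat set set" where
  "skeleton_with_simplex m k d = full_skeleton m k \<union> Pow {1..d + 1}"


section \<open>Reduced simplicial homology over a field\<close>

definition faces :: "nat set set \<Rightarrow> int \<Rightarrow> nat set set" where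
  "faces K i = {\<sigma> \<in> K. simplex_dim \<sigma> = i}"

text \<open>
  The \<open>i\<close>-chains are the functions vanishing outside the \<open>i\<close>-dimensional faces. The
  fields \<open>mult\<close> and \<open>one\<close> that a module record inherits from rings play no role.
\<close>

definition chain_module :: "nat set set \<Rightarrow> int \<Rightarrow> ('f::field, nat set \<Rightarrow> 'f) module" where
  "chain_module K i =
     \<lparr>carrier = {c. \<forall>\<sigma>. \<sigma> \<notin> faces K i \<longrightarrow> c \<sigma> = 0},
      mult = undefined, one = undefined,
      zero = (\<lambda>\<sigma>. 0), add = (\<lambda>b c \<sigma>. b \<sigma> + c \<sigma>),
      smult = (\<lambda>a c \<sigma>. a * c \<sigma>)\<rparr>"

text \<open>
  Simplices are oriented by the order of their vertices: the boundary of \<open>\<sigma>\<close> is the sum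
  over \<open>v \<in> \<sigma>\<close> of \<open>\<sigma> - {v}\<close>, with sign \<open>(-1) ^ j\<close> where \<open>j\<close> is the position of \<open>v\<close>
  in \<open>\<sigma>\<close>, counted from 0. In degree 0 this is the augmentation onto the
  chains on the empty simplex.
\<close>

definition boundary :: "nat set set \<Rightarrow> int \<Rightarrow> (nat set \<Rightarrow> 'f::field) \<Rightarrow> nat set \<Rightarrow> 'f" where
  "boundary K i c = (\<lambda>\<tau>. \<Sum>\<sigma>\<in>faces K i. \<Sum>v\<in>\<sigma>.
     if \<tau> = \<sigma> - {v} then (- 1) ^ card {w \<in> \<sigma>. w < v} * c \<sigma> else 0)"

definition cycles :: "nat set set \<Rightarrow> int \<Rightarrow> (nat set \<Rightarrow> 'f::field) set" where
  "cycles K i = {c \<in> carrier (chain_module K i). boundary K i c = (\<lambda>\<tau>. 0)}"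

definition boundaries :: "nat set set \<Rightarrow> int \<Rightarrow> (nat set \<Rightarrow> 'f::field) set" where
  "boundaries K i = boundary K (i + 1) ` carrier (chain_module K (i + 1))"

text \<open>The quotient of a module by a submodule \<open>N\<close>, realised on the cosets of \<open>N\<close>.\<close>

definition quotient_module :: "('a, 'b, 'c) module_scheme \<Rightarrow> 'b set \<Rightarrow> ('a, 'b set) module" where
  "quotient_module M N =
     \<lparr>carrier = a_rcosets\<^bsub>M\<^esub> N,
      mult = undefined, one = undefined,
      zero = N, add = (\<lambda>A B. A <+>\<^bsub>M\<^esub> B),
      smult = (\<lambda>r A. \<Union>a\<in>A. N +>\<^bsub>M\<^esub> (r \<odot>\<^bsub>M\<^esub> a))\<rparr>"

definition reduced_homology ::
  "nat set set \<Rightarrow> int \<Rightarrow> ('f::field, (nat set \<Rightarrow> 'f) set) module" where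
  "reduced_homology K i =
     quotient_module ((chain_module K i)\<lparr>carrier := cycles K i\<rparr>) (boundaries K i)"

definition reduced_betti :: "'f::field itself \<Rightarrow> nat set set \<Rightarrow> int \<Rightarrow> nat" where
  "reduced_betti F K i =
     vectorspace.dim (class_ring :: 'f ring)
       (reduced_homology K i :: ('f, (nat set \<Rightarrow> 'f) set) module)"

definition total_reduced_betti :: "'f::field itself \<Rightarrow> nat set set \<Rightarrow> nat" where
  "total_reduced_betti F K = (\<Sum>i\<in>{-1..complex_dim K}. reduced_betti F K i)"


section \<open>Complexes maximising the total reduced Betti number\<close>

definition Sigma_complexes :: "nat \<Rightarrow> nat \<Rightarrow> nat set set set" where
  "Sigma_complexes m d = {K. simplicial_complex_on m K \<and> complex_dim K = int d}"

definition Sigma_tb :: "'f::field itself \<Rightarrow> nat \<Rightarrow> nat \<Rightarrow> nat set set set" where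
  "Sigma_tb F m d =
     {K \<in> Sigma_complexes m d.
        total_reduced_betti F K = Max (total_reduced_betti F ` Sigma_complexes m d)}"

text \<open>
  The closure of a family under isomorphism among complexes with vertex set \<open>{1..m}\<close>. As
  \<open>Sigma_tb F m d\<close> is itself closed, it is the family \<open>T\<close> up to isomorphism
  precisely when it equals \<open>iso_copies m T\<close>.
\<close>

definition iso_copies :: "nat \<Rightarrow> nat set set set \<Rightarrow> nat set set set" where
  "iso_copies m T = {K. simplicial_complex_on m K \<and> (\<exists>L\<in>T. simplicial_iso K L)}"

end

theory Submission
  imports Defs "HOL-Library.Nat_Bijection"
begin

text \<open>
  Fix a face \<open>\<sigma>\<close> of \<open>K\<close> of dimension \<open>d\<close>, a vertex \<open>p\<close> of \<open>\<sigma>\<close>, and a linear order on the sets not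
  containing \<open>p\<close> that is compatible with removing vertices. A cycle is determined by its coefficients on
  these sets, so the dimension of a space of cycles is the number of sets that occur as the leading
  position of one of its elements. If \<open>S\<close> leads a cycle and \<open>v \<in> S\<close>, then \<open>S - {v}\<close> leads a boundary.
  Hence the critical sets, which lead cycles but not boundaries, form an antichain whose cardinality is
  the total reduced Betti number, and no critical set lies in \<open>\<sigma> - {p}\<close>. The bound is therefore a
  variant of Sperner's theorem. In the case of equality the critical sets form a complete level
  \<open>h\<close>; then every set of size \<open>h\<close> is a face, and all larger faces lie in \<open>\<sigma>\<close>.
\<close>

section \<open>Antichains avoiding the subsets of a given set\<close>

text \<open>Only the fact that boundary coefficients are signs is used, so the outcome is the same
  over every field. Removing \<open>p\<close> leaves a ground set of \<open>m - 1\<close> points in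
  which all subsets of the \<open>d\<close>-set \<open>\<sigma> - {p}\<close> are forbidden; the
  maximum is thus \<open>((m - 1) choose h) - (d choose h)\<close>. Here
  \<open>h = min (d + 1) (m div 2)\<close>, because critical sets have at most \<open>d + 1\<close>
  elements and \<open>m div 2\<close> is half of \<open>m - 1\<close> rounded up. Rounding up is
  right because the forbidden subsets cost the lower of two middle levels more. The only tie occurs
  for odd \<open>m = d + 2\<close>: a single vertex lies outside \<open>\<sigma>\<close>, and levels
  \<open>h\<close> and \<open>h + 1\<close> keep equally many sets. The obstacle in the case of
  equality is that Sperner's theorem only yields leading positions, while the complex itself is
  wanted. It is overcome because nested spaces with the same leading positions coincide: the cycles
  of \<open>K\<close> on \<open>h\<close>-sets must be all those of the full simplex, and the
  boundaries exactly those of \<open>Pow \<sigma>\<close>.\<close>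

lemma degree_counting:
  fixes s t :: nat
  assumes fin: "finite A" "finite B"
    and degA: "\<And>a. a \<in> A \<Longrightarrow> s \<le> card {b \<in> B. R a b}"
    and degB: "\<And>b. b \<in> B \<Longrightarrow> card {a \<in> A. R a b} \<le> t"
    and ts: "t \<le> s" "0 < s"
  shows "card A \<le> card B"
    and "card A = card B \<Longrightarrow> A \<noteq> {} \<Longrightarrow>
      s = t \<and> (\<forall>a\<in>A. card {b \<in> B. R a b} = s) \<and> (\<forall>b\<in>B. card {a \<in> A. R a b} = t)"
proof -
  have dc: "(\<Sum>a\<in>A. card {b \<in> B. R a b}) = (\<Sum>b\<in>B. card {a \<in> A. R a b})"
    using sum.swap_restrict[OF fin, of "\<lambda>_ _. 1::nat" R] by simp
  have lo: "s * card A \<le> (\<Sum>a\<in>A. card {b \<in> B. R a b})"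
    using sum_mono[OF degA, of A "\<lambda>x. x"] by (simp add: mult.commute)
  have hi: "(\<Sum>b\<in>B. card {a \<in> A. R a b}) \<le> t * card B"
    using sum_mono[OF degB, of B "\<lambda>x. x"] by (simp add: mult.commute)
  have "t * card B \<le> s * card B" using ts by simp
  with lo hi dc have "s * card A \<le> s * card B" by linarith
  then show "card A \<le> card B" using ts by simp
  \<comment> \<open>With equal sizes the two estimates sandwich the number of related pairs, so
    every element attains its degree bound. This regularity is what identifies the extremal families
    later.\<close>
  assume eq: "card A = card B" and ne: "A \<noteq> {}"
  then have pos: "card B > 0" using fin by (metis card_gt_0_iff)
  have "s * card A \<le> t * card B" using lo hi dc by linarith
  then have st: "s = t" using eq pos ts by simp
  have sA: "(\<Sum>a\<in>A. card {b \<in> B. R a b}) = (\<Sum>a\<in>A. s)"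
    and sB: "(\<Sum>b\<in>B. card {a \<in> A. R a b}) = (\<Sum>b\<in>B. t)"
    using lo hi dc eq st by (auto simp: mult.commute)
  have "card {b \<in> B. R a b} = s" if "a \<in> A" for a
  proof (rule ccontr)
    assume "card {b \<in> B. R a b} \<noteq> s"
    then have "s < card {b \<in> B. R a b}" using degA[OF that] by simp
    then have "(\<Sum>a\<in>A. s) < (\<Sum>a\<in>A. card {b \<in> B. R a b})"
      using that fin degA by (intro sum_strict_mono_ex1) auto
    then show False using sA by simp
  qed
  moreover have "card {a \<in> A. R a b} = t" if "b \<in> B" for b
  proof (rule ccontr)
    assume "card {a \<in> A. R a b} \<noteq> t"
    then have "card {a \<in> A. R a b} < t" using degB[OF that] by simp
    then have "(\<Sum>b\<in>B. card {a \<in> A. R a b}) < (\<Sum>b\<in>B. t)"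
      using that fin degB by (intro sum_strict_mono_ex1) auto
    then show False using sB by simp
  qed
  ultimately show "s = t \<and> (\<forall>a\<in>A. card {b \<in> B. R a b} = s) \<and> (\<forall>b\<in>B. card {a \<in> A. R a b} = t)"
    using st by blast
qed

text \<open>Any two \<open>l\<close>-subsets of \<open>X\<close> are joined by single exchanges:
  trading an element of \<open>S - T\<close> for one of \<open>T - S\<close> decreases
  \<open>card (T - S)\<close>.\<close>

lemma exchange_closed_imp_level:
  assumes X: "finite X" and L: "L \<subseteq> {S. S \<subseteq> X \<and> card S = l}" and ne: "L \<noteq> {}"
    and ex: "\<And>S x y. S \<in> L \<Longrightarrow> x \<in> X - S \<Longrightarrow> y \<in> S \<Longrightarrow> insert x S - {y} \<in> L"
  shows "L = {S. S \<subseteq> X \<and> card S = l}"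
proof
  show "{S. S \<subseteq> X \<and> card S = l} \<subseteq> L"
  proof clarify
    fix T assume T: "T \<subseteq> X" "l = card T"
    obtain S where "S \<in> L" using ne by blast
    then show "T \<in> L"
    proof (induction "card (T - S)" arbitrary: S rule: less_induct)
      case less
      have S: "S \<subseteq> X" "card S = card T" using L less.prems T by auto
      have fin: "finite S" "finite T" using S(1) T(1) X finite_subset by blast+
      show ?case
      proof (cases "T \<subseteq> S")
        case True
        then show ?thesis using card_subset_eq[OF fin(1) True] S less.prems by simp
      next
        case False
        then obtain x where x: "x \<in> T" "x \<notin> S" by blast
        have "\<not> S \<subseteq> T" using card_subset_eq[OF fin(2)] S x by blast
        then obtain y where y: "y \<in> S" "y \<notin> T" by blast
        have "T - (insert x S - {y}) \<subset> T - S" using x y by blast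
        then have "card (T - (insert x S - {y})) < card (T - S)"
          using fin by (intro psubset_card_mono) auto
        moreover have "insert x S - {y} \<in> L" using ex less.prems x y T by blast
        ultimately show ?thesis using less.hyps by blast
      qed
    qed
  qed
qed (use L in auto)

section \<open>Sperner's theorem with forbidden subsets\<close>

definition antichain :: "'a set set \<Rightarrow> bool" where
  "antichain F \<longleftrightarrow> (\<forall>A\<in>F. \<forall>B\<in>F. A \<subseteq> B \<longrightarrow> A = B)"

lemma antichainD: "antichain F \<Longrightarrow> A \<in> F \<Longrightarrow> B \<in> F \<Longrightarrow> A \<subseteq> B \<Longrightarrow> A = B"
  unfolding antichain_def by blast

text \<open>Replacing the lowest level of \<open>F\<close> by its upper shadow keeps an antichain and, below
  the middle, does not decrease the cardinality.\<close>

lemma sperner_lower_half: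
  assumes X: "finite X" and F: "F \<subseteq> Pow X" "antichain F"
    and size: "\<And>A. A \<in> F \<Longrightarrow> l \<le> card A \<and> card A \<le> h"
    and h: "2 * h \<le> card X + 1" "l \<le> h"
  shows "card F \<le> card X choose h \<and> (card F = card X choose h \<longrightarrow>
    (\<exists>T. T \<subseteq> X \<and> card T + 1 = h \<and> T \<notin> F) \<longrightarrow> F = {S. S \<subseteq> X \<and> card S = h})"
  using h(2) F size
proof (induction l arbitrary: F rule: inc_induct)
  case base
  then have sub: "F \<subseteq> {S. S \<subseteq> X \<and> card S = h}" by fastforce
  have fin: "finite {S. S \<subseteq> X \<and> card S = h}" using X by simp
  show ?case
    using card_mono[OF fin sub] card_subset_eq[OF fin sub] n_subsets[OF X, of h] by auto
next
  case (step l)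
  have finF: "finite F" using step.prems(1) X by (meson finite_Pow_iff finite_subset)
  define U where "U = {A \<in> F. card A = l}"
  define V where "V = {B. \<exists>A\<in>U. \<exists>x\<in>X - A. B = insert x A}"
  have U: "A \<subseteq> X" "card A = l" "finite A" if "A \<in> U" for A
    using that step.prems(1) finite_subset[OF _ X] unfolding U_def by auto
  have V: "B \<subseteq> X" "card B = Suc l" "finite B" if "B \<in> V" for B
    using that U unfolding V_def by auto
  have finU: "finite U" using finF unfolding U_def by simp
  have finV: "finite V" using V(1) X by (meson PowI finite_Pow_iff finite_subset subsetI)
  have degU: "card X - l \<le> card {B \<in> V. A \<subseteq> B}" if "A \<in> U" for A
  proof -
    have "(\<lambda>x. insert x A) ` (X - A) \<subseteq> {B \<in> V. A \<subseteq> B}" using that by (auto simp: V_def)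
    moreover have "inj_on (\<lambda>x. insert x A) (X - A)" by (auto simp: inj_on_def)
    ultimately have "card (X - A) \<le> card {B \<in> V. A \<subseteq> B}"
      using finV by (intro card_inj_on_le) auto
    then show ?thesis using U[OF that] by (simp add: card_Diff_subset)
  qed
  have nbrs: "{A \<in> U. A \<subseteq> B} \<subseteq> (\<lambda>y. B - {y}) ` B" if "B \<in> V" for B
  proof
    fix A assume A: "A \<in> {A \<in> U. A \<subseteq> B}"
    then have "card (B - A) = 1" using U V that by (auto simp: card_Diff_subset)
    then obtain y where "B - A = {y}" using card_1_singletonE by blast
    then show "A \<in> (\<lambda>y. B - {y}) ` B" using A by (intro image_eqI[of _ _ y]) auto
  qed
  have degV: "card {A \<in> U. A \<subseteq> B} \<le> Suc l" if "B \<in> V" for B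
    using surj_card_le[OF V(3) nbrs, OF that that] V(2)[OF that] by simp
  \<comment> \<open>Below level \<open>h\<close> there are at least as many ways up,
    \<open>card X - l\<close>, as ways down, \<open>Suc l\<close>. Equality means
    \<open>card X = 2 * l + 1\<close>, which forces \<open>h = Suc l\<close>.\<close>
  have deg: "Suc l \<le> card X - l" "0 < card X - l" using h step.hyps by auto
  note count = degree_counting[where R = "\<lambda>A B. A \<subseteq> B", OF finU finV degU degV deg]
  define F' where "F' = (F - U) \<union> V"
  have above: "\<exists>A\<in>F. A \<subset> B" if "B \<in> V" for B
    using that unfolding V_def U_def by blast
  \<comment> \<open>A shadow set strictly contains a member of the antichain \<open>F\<close>, so it
    is not in \<open>F\<close>; hence the cardinalities of \<open>F - U\<close> and \<open>V\<close>
    add.\<close>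
  have disj: "(F - U) \<inter> V = {}"
    using above antichainD[OF step.prems(2)] by blast
  have F'1: "F' \<subseteq> Pow X" using step.prems(1) V unfolding F'_def by auto
  have big: "Suc l \<le> card A" if "A \<in> F - U" for A
    using step.prems(3)[of A] that unfolding U_def by force
  have F'2: "antichain F'"
    unfolding antichain_def
  proof (intro ballI impI)
    fix A B assume AB: "A \<in> F'" "B \<in> F'" "A \<subseteq> B"
    have finA: "finite A" and finB: "finite B" using AB F'1 X finite_subset by blast+
    show "A = B"
    proof (cases "A \<in> V")
      case True
      then obtain C where C: "C \<in> F" "C \<subset> A" using above by blast
      have "B \<in> V"
      proof (rule ccontr)
        assume "B \<notin> V"
        then have "B \<in> F" using AB unfolding F'_def by blast
        moreover have "C \<subset> B" using C(2) AB(3) by (rule psubset_subset_trans)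
        ultimately show False using antichainD[OF step.prems(2) C(1)] by blast
      qed
      then show ?thesis using True V AB(3) finB card_subset_eq by metis
    next
      case False
      then have A: "A \<in> F - U" using AB unfolding F'_def by blast
      show ?thesis
      proof (cases "B \<in> V")
        case True
        then have "card B \<le> card A" using V big[OF A] by simp
        then show ?thesis using AB(3) finB by (simp add: card_seteq)
      next
        case False
        then have "B \<in> F" using AB unfolding F'_def by blast
        then show ?thesis using A AB(3) antichainD[OF step.prems(2)] by blast
      qed
    qed
  qed
  have F'3: "Suc l \<le> card A \<and> card A \<le> h" if "A \<in> F'" for A
    using that big V step.prems(3) step.hyps unfolding F'_def by fastforce
  note IH = step.IH[OF F'1 F'2 F'3]
  have "F = (F - U) \<union> U" unfolding U_def by blast
  then have cF: "card F = card (F - U) + card U"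
    using finF finU by (metis Diff_disjoint card_Un_disjoint finite_Diff inf_commute)
  have cF': "card F' = card (F - U) + card V"
    unfolding F'_def using finF finV disj by (intro card_Un_disjoint) auto
  have le: "card F \<le> card F'" using count(1) cF cF' by simp
  show ?case
  proof (intro conjI impI)
    show "card F \<le> card X choose h" using le IH by linarith
    assume eq: "card F = card X choose h" and "\<exists>T. T \<subseteq> X \<and> card T + 1 = h \<and> T \<notin> F"
    then obtain T where T: "T \<subseteq> X" "card T + 1 = h" "T \<notin> F" by blast
    have UV: "card U = card V" using eq le IH cF cF' count(1) by linarith
    \<comment> \<open>A nonempty lowest level as small as its shadow would be regular: all facets of
      each shadow set would lie in \<open>U\<close>. Then \<open>U\<close> is closed under
      exchanges, so it is the whole level \<open>h - 1\<close>, contrary to the missing set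
      \<open>T\<close>.\<close>
    have "U = {}"
    proof (rule ccontr)
      assume ne: "U \<noteq> {}"
      have ct: "card X - l = Suc l" "\<forall>B\<in>V. card {A \<in> U. A \<subseteq> B} = Suc l"
        using count(2)[OF _ _ UV ne] by auto
      then have lh: "Suc l = h" using h step.hyps by auto
      have exch: "insert x S - {y} \<in> U" if "S \<in> U" "x \<in> X - S" "y \<in> S" for S x y
      proof -
        let ?B = "insert x S"
        have B: "?B \<in> V" using that unfolding V_def by blast
        have "card ((\<lambda>y. ?B - {y}) ` ?B) \<le> card ?B" using V(3)[OF B] by (rule card_image_le)
        then have "{A \<in> U. A \<subseteq> ?B} = (\<lambda>y. ?B - {y}) ` ?B"
          using nbrs[OF B] ct(2) B V[OF B] by (intro card_seteq) auto
        then show ?thesis using that by blast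
      qed
      have "U \<subseteq> {S. S \<subseteq> X \<and> card S = l}" using U by blast
      then have "U = {S. S \<subseteq> X \<and> card S = l}"
        using ne exch by (rule exchange_closed_imp_level[OF X])
      then show False using T lh unfolding U_def by auto
    qed
    then have "F' = F" unfolding F'_def V_def by blast
    then show "F = {S. S \<subseteq> X \<and> card S = h}" using IH eq T by blast
  qed
qed


text \<open>Adding the \<open>h\<close>-subsets of \<open>D\<close> reduces the claim to Sperner's theorem; since \<open>D\<close> has
  a subset of size \<open>h - 1\<close>, level \<open>h - 1\<close> cannot occur in the case of equality.\<close>

lemma sperner_avoiding_lower:
  assumes X: "finite X" and D: "D \<subseteq> X" and F: "F \<subseteq> Pow X - Pow D" "antichain F"
    and size: "\<And>A. A \<in> F \<Longrightarrow> card A \<le> h"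
    and h: "2 * h \<le> card X + 1" "0 < h" "h \<le> card D + 1"
  shows "card F + (card D choose h) \<le> card X choose h"
    and "card F + (card D choose h) = card X choose h \<Longrightarrow> F = {S. S \<subseteq> X \<and> card S = h} - Pow D"
proof -
  have finD: "finite D" using D X by (rule finite_subset)
  define G where "G = F \<union> {S. S \<subseteq> D \<and> card S = h}"
  have finF: "finite F" using F(1) X by (meson Diff_subset finite_Pow_iff finite_subset)
  have disj: "F \<inter> {S. S \<subseteq> D \<and> card S = h} = {}" using F(1) by blast
  have cG: "card G = card F + (card D choose h)"
    unfolding G_def using finF finD disj by (simp add: card_Un_disjoint n_subsets)
  have G: "G \<subseteq> Pow X" using F D unfolding G_def by auto
  have "antichain G"
    unfolding antichain_def
  proof (intro ballI impI)
    fix A B assume AB: "A \<in> G" "B \<in> G" "A \<subseteq> B"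
    have finB: "finite B" using AB G X finite_subset by blast
    show "A = B"
    proof (cases "A \<in> F")
      case True
      \<comment> \<open>Since \<open>A\<close> is not contained in \<open>D\<close>, neither is
        \<open>B\<close>, so \<open>B\<close> is not one of the added sets.\<close>
      then have "B \<in> F" using AB F unfolding G_def by blast
      then show ?thesis using True AB F unfolding antichain_def by blast
    next
      case False
      then have "card B \<le> card A" using AB size unfolding G_def by auto
      then show ?thesis using AB finB by (simp add: card_seteq)
    qed
  qed
  moreover have "0 \<le> card A \<and> card A \<le> h" if "A \<in> G" for A
    using that size unfolding G_def by auto
  ultimately have sp: "card G \<le> card X choose h"
    "card G = card X choose h \<Longrightarrow> \<exists>T. T \<subseteq> X \<and> card T + 1 = h \<and> T \<notin> G \<Longrightarrow> G = {S. S \<subseteq> X \<and> card S = h}"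
    using sperner_lower_half[OF X G, of 0 h] h by auto
  then show "card F + (card D choose h) \<le> card X choose h" using cG by simp
  assume "card F + (card D choose h) = card X choose h"
  moreover have "\<exists>T. T \<subseteq> X \<and> card T + 1 = h \<and> T \<notin> G"
  proof -
    have "h - 1 \<le> card D" using h by simp
    then obtain T where T: "T \<subseteq> D" "card T = h - 1" by (meson obtain_subset_with_card_n)
    then show ?thesis using F(1) D h(2) unfolding G_def by (intro exI[of _ T]) auto
  qed
  ultimately have "G = {S. S \<subseteq> X \<and> card S = h}" using sp cG by simp
  then show "F = {S. S \<subseteq> X \<and> card S = h} - Pow D" using F(1) unfolding G_def by blast
qed

text \<open>Levels above \<open>h\<close> are removed from the top by passing to the lower shadow inside the
  family of sets not contained in \<open>D\<close>. Such a set loses at most one of its facets this way.\<close>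

lemma sperner_avoiding_upper:
  assumes X: "finite X" and D: "D \<subseteq> X" and F: "F \<subseteq> Pow X - Pow D" "antichain F"
    and size: "\<And>A. A \<in> F \<Longrightarrow> card A \<le> u"
    and h: "2 * h \<le> card X + 1" "card X \<le> 2 * h" "0 < h" "h \<le> card D + 1" "h \<le> u"
  shows "card F + (card D choose h) \<le> card X choose h \<and>
    (card F + (card D choose h) = card X choose h \<longrightarrow>
      F = {S. S \<subseteq> X \<and> card S = h} - Pow D \<or>
      card X = 2 * h \<and> card X = card D + 1 \<and> F = {S. S \<subseteq> X \<and> card S = h + 1} - Pow D)"
  using h(5) F size
proof (induction u arbitrary: F rule: dec_induct)
  case base
  then show ?case using sperner_avoiding_lower[OF X D base.prems h(1,3,4)] by blast
next
  case (step u)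
  have finF: "finite F" using step.prems(1) X by (meson Diff_subset finite_Pow_iff finite_subset)
  define U where "U = {A \<in> F. card A = Suc u}"
  define V where "V = {B. \<exists>A\<in>U. \<exists>y\<in>A. B = A - {y} \<and> \<not> B \<subseteq> D}"
  have U: "A \<subseteq> X" "card A = Suc u" "finite A" "\<not> A \<subseteq> D" if "A \<in> U" for A
    using that step.prems(1) finite_subset[OF _ X] unfolding U_def by auto
  have V: "B \<subseteq> X" "card B = u" "finite B" "\<not> B \<subseteq> D" if "B \<in> V" for B
    using that U unfolding V_def by auto
  have finU: "finite U" using finF unfolding U_def by simp
  have finV: "finite V" using V(1) X by (meson PowI finite_Pow_iff finite_subset subsetI)
  have inj: "inj_on (\<lambda>y. A - {y}) A" for A :: "'a set" by (auto simp: inj_on_def)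
  have down: "(\<lambda>y. A - {y}) ` {y \<in> A. \<not> A - {y} \<subseteq> D} \<subseteq> {B \<in> V. B \<subseteq> A}" if "A \<in> U" for A
    using that unfolding V_def by auto
  have card_down: "card {y \<in> A. \<not> A - {y} \<subseteq> D} \<le> card {B \<in> V. B \<subseteq> A}" if "A \<in> U" for A
  proof -
    have "inj_on (\<lambda>y. A - {y}) {y \<in> A. \<not> A - {y} \<subseteq> D}" using inj by (rule inj_on_subset) auto
    then show ?thesis using card_mono[OF _ down[OF that]] finV by (simp add: card_image)
  qed
  have degU: "u \<le> card {B \<in> V. B \<subseteq> A}" if A: "A \<in> U" for A
  proof -
    obtain z where z: "z \<in> A" "z \<notin> D" using U(4)[OF A] by blast
    have "A - {z} \<subseteq> {y \<in> A. \<not> A - {y} \<subseteq> D}" using z by blast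
    then have "card (A - {z}) \<le> card {y \<in> A. \<not> A - {y} \<subseteq> D}"
      using U(3)[OF A] by (intro card_mono) auto
    then show ?thesis using U(2,3)[OF A] z card_down[OF A] by simp
  qed
  have nbrs: "{A \<in> U. B \<subseteq> A} \<subseteq> (\<lambda>x. insert x B) ` (X - B)" if "B \<in> V" for B
  proof
    fix A assume A: "A \<in> {A \<in> U. B \<subseteq> A}"
    then have "card (A - B) = 1" using U V that by (auto simp: card_Diff_subset)
    then obtain y where "A - B = {y}" using card_1_singletonE by blast
    then show "A \<in> (\<lambda>x. insert x B) ` (X - B)" using A U by (intro image_eqI[of _ _ y]) auto
  qed
  have card_up: "card (X - B) = card X - u" if "B \<in> V" for B
    using V[OF that] by (simp add: card_Diff_subset)
  have degV: "card {A \<in> U. B \<subseteq> A} \<le> card X - u" if "B \<in> V" for B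
    using surj_card_le[OF _ nbrs[OF that]] X card_up[OF that] by simp
  \<comment> \<open>From level \<open>h\<close> upwards the ways up, \<open>card X - u\<close>, are
    at most \<open>u\<close>, even after a facet inside \<open>D\<close> has been given up.\<close>
  have deg: "card X - u \<le> u" "0 < u" using h step.hyps by auto
  note count = degree_counting[where R = "\<lambda>A B. B \<subseteq> A", OF finU finV degU degV deg]
  define F' where "F' = (F - U) \<union> V"
  have below: "\<exists>A\<in>F. B \<subset> A" if "B \<in> V" for B
    using that unfolding V_def U_def by blast
  have disj: "(F - U) \<inter> V = {}"
    using below antichainD[OF step.prems(2)] by blast
  have F'1: "F' \<subseteq> Pow X - Pow D" using step.prems(1) V unfolding F'_def by auto
  have small: "card A \<le> u" if "A \<in> F - U" for A
    using step.prems(3)[of A] that unfolding U_def by force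
  have F'2: "antichain F'"
    unfolding antichain_def
  proof (intro ballI impI)
    fix A B assume AB: "A \<in> F'" "B \<in> F'" "A \<subseteq> B"
    have finB: "finite B" using AB F'1 X finite_subset by blast
    show "A = B"
    proof (cases "B \<in> V")
      case True
      then obtain C where C: "C \<in> F" "B \<subset> C" using below by blast
      have "A \<in> V"
      proof (rule ccontr)
        assume "A \<notin> V"
        then have "A \<in> F" using AB unfolding F'_def by blast
        moreover have "A \<subset> C" using AB(3) C(2) by (rule subset_psubset_trans)
        ultimately show False using antichainD[OF step.prems(2) _ C(1)] by blast
      qed
      then show ?thesis using True V AB(3) finB card_subset_eq by metis
    next
      case False
      then have B: "B \<in> F - U" using AB unfolding F'_def by blast
      show ?thesis
      proof (cases "A \<in> V")
        case True
        then have "card B \<le> card A" using V small[OF B] by simp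
        then show ?thesis using AB(3) finB by (simp add: card_seteq)
      next
        case False
        then have "A \<in> F" using AB unfolding F'_def by blast
        then show ?thesis using B AB(3) antichainD[OF step.prems(2)] by blast
      qed
    qed
  qed
  have F'3: "card A \<le> u" if "A \<in> F'" for A
    using that small V unfolding F'_def by fastforce
  note IH = step.IH[OF F'1 F'2 F'3]
  have "F = (F - U) \<union> U" unfolding U_def by blast
  then have cF: "card F = card (F - U) + card U"
    using finF finU by (metis Diff_disjoint card_Un_disjoint finite_Diff inf_commute)
  have cF': "card F' = card (F - U) + card V"
    unfolding F'_def using finF finV disj by (intro card_Un_disjoint) auto
  have le: "card F \<le> card F'" using count(1) cF cF' by simp
  show ?case
  proof (intro conjI impI)
    show "card F + (card D choose h) \<le> card X choose h" using le IH by linarith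
    assume eq: "card F + (card D choose h) = card X choose h"
    have UV: "card U = card V" using eq le IH cF cF' count(1) by linarith
    show "F = {S. S \<subseteq> X \<and> card S = h} - Pow D \<or>
      card X = 2 * h \<and> card X = card D + 1 \<and> F = {S. S \<subseteq> X \<and> card S = h + 1} - Pow D"
    proof (cases "U = {}")
      case True
      then have "F' = F" unfolding F'_def V_def by blast
      then show ?thesis using IH eq by simp
    next
      case False
      have ct: "u = card X - u" "\<And>A. A \<in> U \<Longrightarrow> card {B \<in> V. B \<subseteq> A} = u"
        "\<And>B. B \<in> V \<Longrightarrow> card {A \<in> U. B \<subseteq> A} = card X - u"
        using count(2)[OF _ _ UV False] by auto
      \<comment> \<open>Regularity is possible only at the exact middle, so the top level
        \<open>U\<close> sits at size \<open>h + 1\<close>.\<close>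
      have uh: "u = h" "card X = 2 * h" using ct(1) h step.hyps by linarith+
      have up: "insert x B \<in> U" if "B \<in> V" "x \<in> X - B" for B x
      proof -
        have "card ((\<lambda>x. insert x B) ` (X - B)) \<le> card {A \<in> U. B \<subseteq> A}"
          using card_image_le[of "X - B" "\<lambda>x. insert x B"] X card_up[OF that(1)] ct(3)[OF that(1)]
          by simp
        then have "{A \<in> U. B \<subseteq> A} = (\<lambda>x. insert x B) ` (X - B)"
          using nbrs[OF that(1)] X by (intro card_seteq) auto
        then show ?thesis using that by blast
      qed
      \<comment> \<open>Only \<open>h\<close> of the \<open>h + 1\<close> facets of \<open>A\<close>
        count in \<open>V\<close>, so one facet lies inside \<open>D\<close> and its missing vertex
        is the only element of \<open>A\<close> outside \<open>D\<close>.\<close>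
      have one: "\<exists>z. A - D = {z}" if A: "A \<in> U" for A
      proof -
        have "card {y \<in> A. \<not> A - {y} \<subseteq> D} < card A"
          using card_down[OF A] ct(2)[OF A] U(2)[OF A] by simp
        then obtain y where "y \<in> A" "A - {y} \<subseteq> D"
          by (metis (mono_tags, lifting) less_irrefl mem_Collect_eq subsetI subset_antisym)
        then show ?thesis using U(4)[OF A] by blast
      qed
      obtain A0 where A0: "A0 \<in> U" using False by blast
      obtain z where z: "A0 - D = {z}" using one[OF A0] by blast
      have zX: "z \<in> X" "z \<notin> D" using z U(1)[OF A0] by auto
      \<comment> \<open>A second point \<open>z'\<close> outside \<open>D\<close> could be exchanged
        into \<open>A0\<close> in place of some \<open>v \<in> D\<close>, giving a member of
        \<open>U\<close> with two elements outside \<open>D\<close>.\<close>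
      have XD: "X - D = {z}"
      proof (rule ccontr)
        assume "X - D \<noteq> {z}"
        then obtain z' where z': "z' \<in> X" "z' \<notin> D" "z' \<noteq> z" using zX by blast
        have "A0 \<noteq> {z}" using U(2)[OF A0] deg(2) by auto
        then obtain v where v: "v \<in> A0" "v \<noteq> z" using z by blast
        have "A0 - {v} \<in> V" using A0 v z unfolding V_def by blast
        then have "insert z' (A0 - {v}) \<in> U" using z' z by (intro up) auto
        then obtain w where "insert z' (A0 - {v}) - D = {w}" using one by blast
        moreover have "z \<in> insert z' (A0 - {v}) - D" "z' \<in> insert z' (A0 - {v}) - D"
          using z z' v by auto
        ultimately show False using z'(3) by simp
      qed
      have only_z: "x = z" if "x \<in> X" "x \<notin> D" for x using XD that by auto
      have zin: "z \<in> S" if S: "S \<subseteq> X" "\<not> S \<subseteq> D" for S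
      proof -
        obtain w where "w \<in> S" "w \<notin> D" using S(2) by blast
        then show ?thesis using only_z S(1) by blast
      qed
      have zU: "z \<in> A" if "A \<in> U" for A using zin U(1,4)[OF that] .
      have finD: "finite D" using D X by (rule finite_subset)
      have "X = insert z D" using only_z zX D by blast
      then have cX: "card X = card D + 1" using zX finD by simp
      \<comment> \<open>Every member of \<open>U\<close> contains \<open>z\<close>, so
        \<open>U\<close> is recovered from its link at \<open>z\<close>, which lies at level
        \<open>h\<close> of \<open>D\<close>. Exchange-closure of this link then gives all of
        \<open>U\<close>.\<close>
      define L where "L = (\<lambda>A. A - {z}) ` U"
      have L: "L \<subseteq> {S. S \<subseteq> D \<and> card S = h}"
      proof
        fix S assume "S \<in> L"
        then obtain A where A: "A \<in> U" "S = A - {z}" unfolding L_def by blast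
        then have "S \<subseteq> D" using U(1)[OF A(1)] only_z by blast
        moreover have "card S = h" using A U[OF A(1)] zU[OF A(1)] uh by simp
        ultimately show "S \<in> {S. S \<subseteq> D \<and> card S = h}" by simp
      qed
      have Leq: "L = {S. S \<subseteq> D \<and> card S = h}"
      proof (rule exchange_closed_imp_level[OF finD L])
        show "L \<noteq> {}" using False unfolding L_def by simp
        fix S x y assume S: "S \<in> L" "x \<in> D - S" "y \<in> S"
        then obtain A where A: "A \<in> U" "S = A - {z}" unfolding L_def by blast
        then have "A - {y} \<in> V" using S zU[OF A(1)] zX(2) unfolding V_def by blast
        moreover have "x \<in> X - (A - {y})" using S A D zX by blast
        ultimately have "insert x (A - {y}) \<in> U" by (rule up)
        moreover have "insert x S - {y} = insert x (A - {y}) - {z}" using A S zX by blast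
        ultimately show "insert x S - {y} \<in> L" unfolding L_def by blast
      qed
      have level: "{S. S \<subseteq> X \<and> card S = h + 1} - Pow D \<subseteq> U"
      proof -
        have "S \<in> U" if "S \<subseteq> X" "card S = h + 1" "\<not> S \<subseteq> D" for S
        proof -
          have zS: "z \<in> S" using zin that by blast
          have "finite S" using that X finite_subset by blast
          then have "S - {z} \<in> {S. S \<subseteq> D \<and> card S = h}" using that zS only_z by auto
          then have "S - {z} \<in> L" using Leq by simp
          then obtain A where "A \<in> U" "S - {z} = A - {z}" unfolding L_def by blast
          then show ?thesis using zS zU by (metis insert_Diff)
        qed
        then show ?thesis by blast
      qed
      have "F \<subseteq> {S. S \<subseteq> X \<and> card S = h + 1} - Pow D"
      proof
        fix A assume A: "A \<in> F"
        have AX: "A \<subseteq> X" "\<not> A \<subseteq> D" using A step.prems(1) by auto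
        have finA: "finite A" using AX X finite_subset by blast
        have "card A \<le> h + 1" using step.prems(3)[OF A] uh by simp
        \<comment> \<open>Filling \<open>A\<close> up to size \<open>h + 1\<close> gives a set not
          inside \<open>D\<close>, hence a member of \<open>U \<subseteq> F\<close>; in an antichain
          it must be \<open>A\<close> itself.\<close>
        then obtain k where k: "h + 1 = card A + k" using le_Suc_ex by blast
        have "k \<le> card (X - A)" using AX finA k uh h(3) by (simp add: card_Diff_subset)
        then obtain R where R: "R \<subseteq> X - A" "card R = k" by (meson obtain_subset_with_card_n)
        have cAR: "card (A \<union> R) = h + 1"
          using R k finA X by (subst card_Un_disjoint) (auto intro: finite_subset)
        then have "A \<union> R \<in> {S. S \<subseteq> X \<and> card S = h + 1} - Pow D" using AX R(1) by auto
        then have "A \<union> R \<in> U" by (rule subsetD[OF level])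
        then have "A \<union> R \<in> F" unfolding U_def by simp
        then have "A = A \<union> R" using A by (intro antichainD[OF step.prems(2)]) auto
        then show "A \<in> {S. S \<subseteq> X \<and> card S = h + 1} - Pow D"
          using cAR AX by simp
      qed
      moreover have "U \<subseteq> F" unfolding U_def by blast
      ultimately have "F = {S. S \<subseteq> X \<and> card S = h + 1} - Pow D" using level by blast
      then show ?thesis using uh cX by blast
    qed
  qed
qed

section \<open>Quotients of function spaces\<close>

definition lin_closed :: "('a \<Rightarrow> 'f::field) set \<Rightarrow> bool" where
  "lin_closed W \<longleftrightarrow> (\<lambda>x. 0) \<in> W \<and> (\<forall>y\<in>W. \<forall>z\<in>W. (\<lambda>x. y x + z x) \<in> W) \<and>
     (\<forall>a. \<forall>z\<in>W. (\<lambda>x. a * z x) \<in> W)"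

lemma lin_closedI:
  assumes "(\<lambda>x. 0) \<in> W" "\<And>y z. y \<in> W \<Longrightarrow> z \<in> W \<Longrightarrow> (\<lambda>x. y x + z x) \<in> W"
    "\<And>a z. z \<in> W \<Longrightarrow> (\<lambda>x. a * z x) \<in> W"
  shows "lin_closed W"
  using assms by (simp add: lin_closed_def)

lemma lin_closedD:
  assumes "lin_closed W"
  shows "(\<lambda>x. 0) \<in> W" "y \<in> W \<Longrightarrow> z \<in> W \<Longrightarrow> (\<lambda>x. y x + z x) \<in> W"
    "z \<in> W \<Longrightarrow> (\<lambda>x. a * z x) \<in> W" "y \<in> W \<Longrightarrow> z \<in> W \<Longrightarrow> (\<lambda>x. y x - z x) \<in> W"
proof -
  have add: "(\<lambda>x. u x + v x) \<in> W" if "u \<in> W" "v \<in> W" for u v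
    using assms that by (simp add: lin_closed_def)
  show "(\<lambda>x. y x - z x) \<in> W" if "y \<in> W" "z \<in> W"
  proof -
    have "(\<lambda>x. (-1) * z x) \<in> W" using assms that unfolding lin_closed_def by blast
    from add[OF that(1) this] show ?thesis by simp
  qed
qed (use assms in \<open>auto simp: lin_closed_def\<close>)

lemma lin_closed_sum:
  assumes "lin_closed W" "\<And>i. i \<in> I \<Longrightarrow> f i \<in> W"
  shows "(\<lambda>x. \<Sum>i\<in>I. c i * f i x) \<in> W"
  using assms(2)
proof (induction I rule: infinite_finite_induct)
  case (insert i I)
  then show ?case
    using lin_closedD(2)[OF assms(1), OF lin_closedD(3)[OF assms(1), of "f i" "c i"]] by simp
qed (use lin_closedD(1)[OF assms(1)] in auto)

text \<open>The fields agree with those of \<open>chain_module\<close>, so the module of cycles is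
  an instance by plain equality of records.\<close>

definition fun_module :: "('a \<Rightarrow> 'f::field) set \<Rightarrow> ('f, 'a \<Rightarrow> 'f) module" where
  "fun_module Z = \<lparr>carrier = Z, mult = undefined, one = undefined, zero = (\<lambda>x. 0),
     add = (\<lambda>b c x. b x + c x), smult = (\<lambda>a c x. a * c x)\<rparr>"

definition fun_coset :: "('a \<Rightarrow> 'f::field) set \<Rightarrow> ('a \<Rightarrow> 'f) \<Rightarrow> ('a \<Rightarrow> 'f) set" where
  "fun_coset B z = {y. (\<lambda>x. y x - z x) \<in> B}"

lemma fun_coset_eq_iff:
  assumes "lin_closed B"
  shows "fun_coset B y = fun_coset B z \<longleftrightarrow> (\<lambda>x. y x - z x) \<in> B"
proof
  assume "fun_coset B y = fun_coset B z"
  moreover have "y \<in> fun_coset B y" using lin_closedD(1)[OF assms] by (simp add: fun_coset_def)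
  ultimately show "(\<lambda>x. y x - z x) \<in> B" by (simp add: fun_coset_def)
next
  assume *: "(\<lambda>x. y x - z x) \<in> B"
  have "(\<lambda>x. u x - z x) \<in> B" if "(\<lambda>x. u x - y x) \<in> B" for u
    using lin_closedD(2)[OF assms that *] by simp
  moreover have "(\<lambda>x. u x - y x) \<in> B" if "(\<lambda>x. u x - z x) \<in> B" for u
    using lin_closedD(4)[OF assms that *] by simp
  ultimately show "fun_coset B y = fun_coset B z" by (auto simp: fun_coset_def)
qed

lemma r_coset_fun_module:
  "B +>\<^bsub>fun_module Z\<^esub> z = fun_coset B z"
proof -
  have "\<exists>h\<in>B. y = (\<lambda>x. h x + z x)" if "(\<lambda>x. y x - z x) \<in> B" for y
    using that by (intro bexI[of _ "\<lambda>x. y x - z x"]) auto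
  then show ?thesis
    by (auto simp: a_r_coset_def' fun_module_def fun_coset_def)
qed

lemma quotient_fun_module:
  assumes B: "lin_closed B"
  shows "carrier (quotient_module (fun_module Z) B) = fun_coset B ` Z"
    and "zero (quotient_module (fun_module Z) B) = fun_coset B (\<lambda>x. 0)"
    and "add (quotient_module (fun_module Z) B) (fun_coset B y) (fun_coset B z)
           = fun_coset B (\<lambda>x. y x + z x)"
    and "smult (quotient_module (fun_module Z) B) a (fun_coset B z)
           = fun_coset B (\<lambda>x. a * z x)"
proof -
  have "a_rcosets\<^bsub>fun_module Z\<^esub> B = fun_coset B ` Z"
    unfolding A_RCOSETS_def' r_coset_fun_module by (auto simp: fun_module_def)
  then show "carrier (quotient_module (fun_module Z) B) = fun_coset B ` Z"
    by (simp add: quotient_module_def)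
  show "zero (quotient_module (fun_module Z) B) = fun_coset B (\<lambda>x. 0)"
    by (simp add: quotient_module_def fun_coset_def)
  have "\<exists>h\<in>fun_coset B y. \<exists>k\<in>fun_coset B z. u = (\<lambda>x. h x + k x)"
    if "u \<in> fun_coset B (\<lambda>x. y x + z x)" for u
    using that lin_closedD(1)[OF B]
    by (intro bexI[of _ "\<lambda>x. u x - z x"] bexI[of _ z])
       (auto simp: fun_coset_def algebra_simps)
  moreover have "(\<lambda>x. h x + k x) \<in> fun_coset B (\<lambda>x. y x + z x)"
    if "h \<in> fun_coset B y" "k \<in> fun_coset B z" for h k
    using lin_closedD(2)[OF B, of "\<lambda>x. h x - y x" "\<lambda>x. k x - z x"] that
    by (simp add: fun_coset_def algebra_simps)
  ultimately have "fun_coset B y <+>\<^bsub>fun_module Z\<^esub> fun_coset B z = fun_coset B (\<lambda>x. y x + z x)"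
    unfolding set_add_def set_mult_def by (auto simp: fun_module_def)
  then show "add (quotient_module (fun_module Z) B) (fun_coset B y) (fun_coset B z)
           = fun_coset B (\<lambda>x. y x + z x)"
    by (simp add: quotient_module_def)
  have "fun_coset B (\<lambda>x. a * u x) = fun_coset B (\<lambda>x. a * z x)" if "u \<in> fun_coset B z" for u
    using lin_closedD(3)[OF B, of "\<lambda>x. u x - z x" a] that fun_coset_eq_iff[OF B]
    by (simp add: fun_coset_def algebra_simps)
  \<comment> \<open>\<open>quotient_module\<close> scales a coset by a union over its
    representatives. All of them give the same coset, and the union collapses to it because there is
    at least one.\<close>
  moreover have "z \<in> fun_coset B z" using lin_closedD(1)[OF B] by (simp add: fun_coset_def)
  ultimately have *: "(\<Union>u\<in>fun_coset B z. fun_coset B (\<lambda>x. a * u x)) = fun_coset B (\<lambda>x. a * z x)"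
    by blast
  have "smult (quotient_module (fun_module Z) B) a U = (\<Union>u\<in>U. fun_coset B (\<lambda>x. a * u x))" for U
    unfolding quotient_module_def module.simps r_coset_fun_module by (simp add: fun_module_def)
  with * show "smult (quotient_module (fun_module Z) B) a (fun_coset B z)
           = fun_coset B (\<lambda>x. a * z x)"
    by (simp only:)
qed

lemma vectorspace_quotient:
  fixes Z B :: "('a \<Rightarrow> 'f::field) set"
  assumes Z: "lin_closed Z" and B: "lin_closed B"
  shows "vectorspace class_ring (quotient_module (fun_module Z) B)"
proof -
  let ?Q = "quotient_module (fun_module Z) B"
  note Q = quotient_fun_module[OF B]
  note Zc = lin_closedD[OF Z]
  have ab: "abelian_group ?Q"
  proof (rule abelian_groupI)
    fix u assume "u \<in> carrier ?Q"
    then obtain z where z: "z \<in> Z" "u = fun_coset B z" by (auto simp: Q)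
    have "(\<lambda>x. - z x) \<in> Z" using Zc(3)[OF z(1), of "-1"] by simp
    then show "\<exists>v\<in>carrier ?Q. v \<oplus>\<^bsub>?Q\<^esub> u = \<zero>\<^bsub>?Q\<^esub>"
      using z by (intro bexI[of _ "fun_coset B (\<lambda>x. - z x)"]) (auto simp: Q)
  qed (use Zc in \<open>auto simp: Q add_ac\<close>)
  have "module class_ring ?Q"
    by (rule Module.moduleI[OF class_cring.is_cring ab])
       (use Zc in \<open>auto simp: Q algebra_simps\<close>)
  then show ?thesis
    by (simp add: vectorspace_def class_field)
qed

text \<open>The family \<open>e\<close> is a basis modulo \<open>B\<close>. Coefficient vectors map
  bijectively and linearly onto the quotient, so the dimension is transported from the coordinate
  space of dimension \<open>card A\<close>.\<close>

lemma dim_quotient: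
  fixes Z B :: "('a \<Rightarrow> 'f::field) set" and e :: "'b \<Rightarrow> 'a \<Rightarrow> 'f"
  assumes Z: "lin_closed Z" and B: "lin_closed B" and A: "finite A"
    and e: "\<And>i. i \<in> A \<Longrightarrow> e i \<in> Z"
    and indep: "\<And>c. (\<lambda>x. \<Sum>i\<in>A. c i * e i x) \<in> B \<Longrightarrow> \<forall>i\<in>A. c i = 0"
    and span: "\<And>z. z \<in> Z \<Longrightarrow> \<exists>c. (\<lambda>x. z x - (\<Sum>i\<in>A. c i * e i x)) \<in> B"
  shows "vectorspace.dim (class_ring :: 'f ring) (quotient_module (fun_module Z) B) = card A"
proof -
  let ?Q = "quotient_module (fun_module Z) B"
  define N where "N = card A"
  obtain \<phi> where \<phi>: "bij_betw \<phi> {..<N} A"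
    using ex_bij_betw_nat_finite[OF A] unfolding N_def atLeast0LessThan by blast
  define \<psi> where "\<psi> = the_inv_into {..<N} \<phi>"
  have \<psi>: "\<psi> (\<phi> i) = i" if "i < N" for i
    using \<phi> that unfolding \<psi>_def bij_betw_def by (simp add: the_inv_into_f_f)
  have sumA: "(\<Sum>i\<in>A. c (\<psi> i) * e i x) = (\<Sum>i<N. c i * e (\<phi> i) x)" for c x
    using sum.reindex_bij_betw[OF \<phi>, of "\<lambda>i. c (\<psi> i) * e i x"] \<psi> by simp
  define L where "L v = (\<lambda>x. \<Sum>i<N. v $ i * e (\<phi> i) x)" for v :: "'f vec"
  define T where "T v = fun_coset B (L v)" for v
  have LZ: "L v \<in> Z" for v
    unfolding L_def using \<phi> e by (intro lin_closed_sum[OF Z]) (auto simp: bij_betw_def)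
  have Ladd: "L (v + w) = (\<lambda>x. L v x + L w x)" if "v \<in> carrier_vec N" "w \<in> carrier_vec N" for v w
    using that by (auto simp: L_def algebra_simps sum.distrib)
  have Lsmult: "L (a \<cdot>\<^sub>v v) = (\<lambda>x. a * L v x)" if "v \<in> carrier_vec N" for a v
    using that by (auto simp: L_def algebra_simps sum_distrib_left)
  note Q = quotient_fun_module[OF B]
  interpret V: vec_space "TYPE('f)" N .
  have lm: "linear_map class_ring (module_vec TYPE('f) N) ?Q T"
  proof (intro linear_map.intro mod_hom.intro mod_hom_axioms.intro)
    show "vectorspace class_ring (module_vec TYPE('f) N)" by (rule V.vectorspace_axioms)
    then show "module class_ring (module_vec TYPE('f) N)" by (simp add: vectorspace_def)
    show "vectorspace class_ring ?Q" by (rule vectorspace_quotient[OF Z B])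
    then show "module class_ring ?Q" by (simp add: vectorspace_def)
    show "T \<in> LinearCombinations.module_hom class_ring (module_vec TYPE('f) N) ?Q"
      using LZ by (simp add: LinearCombinations.module_hom_def module_vec_simps Q T_def Ladd Lsmult)
  qed
  have inj: "inj_on T (carrier_vec N)"
  proof (rule inj_onI)
    fix v w assume vw: "v \<in> carrier_vec N" "w \<in> carrier_vec N" "T v = T w"
    then have LB: "(\<lambda>x. L v x - L w x) \<in> B" by (simp add: T_def fun_coset_eq_iff[OF B])
    have "(\<lambda>x. L v x - L w x) = (\<lambda>x. \<Sum>i\<in>A. (v $ \<psi> i - w $ \<psi> i) * e i x)"
      using sumA[of "\<lambda>i. v $ i - w $ i"]
      by (simp add: fun_eq_iff L_def algebra_simps sum_subtractf)
    with LB have "(\<lambda>x. \<Sum>i\<in>A. (v $ \<psi> i - w $ \<psi> i) * e i x) \<in> B" by (simp only:)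
    then have *: "\<forall>i\<in>A. v $ \<psi> i - w $ \<psi> i = 0"
      by (rule indep)
    have "v $ i = w $ i" if "i < N" for i
    proof -
      have "\<phi> i \<in> A" using \<phi> that by (auto simp: bij_betw_def)
      then show ?thesis using * \<psi>[OF that] by fastforce
    qed
    then show "v = w" using vw(1,2) by (intro eq_vecI) auto
  qed
  have surj: "T ` carrier_vec N = carrier ?Q"
  proof
    show "T ` carrier_vec N \<subseteq> carrier ?Q" using LZ by (auto simp: Q T_def)
    show "carrier ?Q \<subseteq> T ` carrier_vec N"
    proof
      fix u assume "u \<in> carrier ?Q"
      then obtain z where z: "z \<in> Z" "u = fun_coset B z" by (auto simp: Q)
      obtain c where c: "(\<lambda>x. z x - (\<Sum>i\<in>A. c i * e i x)) \<in> B" using span[OF z(1)] by blast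
      let ?v = "vec N (\<lambda>i. c (\<phi> i))"
      have "L ?v x = (\<Sum>i\<in>A. c i * e i x)" for x
        using sum.reindex_bij_betw[OF \<phi>, of "\<lambda>i. c i * e i x"] by (simp add: L_def)
      then have "u = T ?v" using c z(2) by (simp add: T_def fun_coset_eq_iff[OF B])
      then show "u \<in> T ` carrier_vec N" by auto
    qed
  qed
  have "V.dim = vectorspace.dim (class_ring :: 'f ring) ?Q"
  proof (rule linear_map.dim_eq[OF lm])
    show "V.fin_dim" by (rule V.fin_dim)
    show "inj_on T (carrier (module_vec TYPE('f) N))" using inj by (simp add: module_vec_simps)
    show "T ` carrier (module_vec TYPE('f) N) = carrier ?Q" using surj by (simp add: module_vec_simps)
  qed
  with V.dim_is_n have "vectorspace.dim (class_ring :: 'f ring) ?Q = N" by metis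
  then show ?thesis by (simp only: N_def)
qed

section \<open>Leading positions\<close>

text \<open>For \<open>w\<close> injective on the finite set \<open>\<Omega>\<close> and linear
  \<open>W\<close>, these are the pivot columns of an echelon form of the elements of
  \<open>W\<close> restricted to \<open>\<Omega>\<close>.\<close>

definition leads :: "'a set \<Rightarrow> ('a \<Rightarrow> nat) \<Rightarrow> ('a \<Rightarrow> 'f::field) set \<Rightarrow> 'a set" where
  "leads \<Omega> w W = {S \<in> \<Omega>. \<exists>z\<in>W. z S \<noteq> 0 \<and> (\<forall>T\<in>\<Omega>. z T \<noteq> 0 \<longrightarrow> w T \<le> w S)}"

lemma leads_mono: "V \<subseteq> W \<Longrightarrow> leads \<Omega> w V \<subseteq> leads \<Omega> w W"
  unfolding leads_def by blast

text \<open>Gaussian elimination from the top: the leading coefficient of \<open>z\<close> is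
  cancelled by an element of \<open>B\<close> if its position leads \<open>B\<close>, and otherwise
  by the member of \<open>e\<close> at that position. The bound \<open>k\<close> on the weights
  drops at each round.\<close>

lemma leads_reduce:
  fixes Z B :: "('a \<Rightarrow> 'f::field) set" and e :: "'a \<Rightarrow> 'a \<Rightarrow> 'f"
  assumes \<Omega>: "inj_on w \<Omega>" and Z: "lin_closed Z" and B: "lin_closed B" "B \<subseteq> Z"
    and A: "finite A" "leads \<Omega> w Z \<subseteq> leads \<Omega> w B \<union> A"
    and e: "\<And>a. a \<in> A \<Longrightarrow> e a \<in> Z \<and> e a a \<noteq> 0 \<and> (\<forall>T\<in>\<Omega>. e a T \<noteq> 0 \<longrightarrow> w T \<le> w a)"
    and z: "z \<in> Z" "\<And>T. T \<in> \<Omega> \<Longrightarrow> z T \<noteq> 0 \<Longrightarrow> w T < k"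
  shows "\<exists>c. \<exists>b\<in>B. \<forall>S\<in>\<Omega>. z S = b S + (\<Sum>a\<in>A. c a * e a S)"
  using z
proof (induction k arbitrary: z)
  case 0
  then show ?case
    using lin_closedD(1)[OF B(1)] by (intro exI[of _ "\<lambda>_. 0"] bexI[of _ "\<lambda>_. 0"]) auto
next
  case (Suc k)
  show ?case
  proof (cases "\<exists>S\<in>\<Omega>. z S \<noteq> 0 \<and> w S = k")
    case False
    then have "w T < k" if "T \<in> \<Omega>" "z T \<noteq> 0" for T
      using Suc.prems(2)[OF that] that by (metis less_antisym)
    then show ?thesis using Suc.IH[OF Suc.prems(1)] by blast
  next
    case True
    then obtain S where S: "S \<in> \<Omega>" "z S \<noteq> 0" "w S = k" by blast
    have S_lead: "S \<in> leads \<Omega> w Z"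
      unfolding leads_def using S Suc.prems by (auto intro!: bexI[of _ z] simp: less_Suc_eq_le)
    \<comment> \<open>The multiple of \<open>y\<close> is chosen to cancel the coefficient at
      \<open>S\<close>. As \<open>w\<close> is injective, no other position has weight
      \<open>k\<close>.\<close>
    have step: "\<exists>c. \<exists>b\<in>B. \<forall>T\<in>\<Omega>. z T - z S / y S * y T = b T + (\<Sum>a\<in>A. c a * e a T)"
      if y: "y \<in> Z" "y S \<noteq> 0" "\<forall>T\<in>\<Omega>. y T \<noteq> 0 \<longrightarrow> w T \<le> w S" for y
    proof (rule Suc.IH)
      show "(\<lambda>T. z T - z S / y S * y T) \<in> Z"
        by (intro lin_closedD(4)[OF Z] lin_closedD(3)[OF Z] y Suc.prems)
      fix T assume T: "T \<in> \<Omega>" "z T - z S / y S * y T \<noteq> 0"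
      then have "z T \<noteq> 0 \<or> y T \<noteq> 0" by auto
      then have "w T \<le> k" using y(3) T(1) S(3) Suc.prems(2)[OF T(1)] by auto
      moreover have "T \<noteq> S" using T y(2) by auto
      then have "w T \<noteq> k" using S T(1) \<Omega> by (auto dest: inj_onD)
      ultimately show "w T < k" by simp
    qed
    show ?thesis
    proof (cases "S \<in> leads \<Omega> w B")
      case True
      then obtain y where y: "y \<in> B" "y S \<noteq> 0" "\<forall>T\<in>\<Omega>. y T \<noteq> 0 \<longrightarrow> w T \<le> w S"
        unfolding leads_def by blast
      then obtain c b where cb: "b \<in> B"
        "\<forall>T\<in>\<Omega>. z T - z S / y S * y T = b T + (\<Sum>a\<in>A. c a * e a T)"
        using step[of y] B(2) by blast
      have "(\<lambda>T. b T + z S / y S * y T) \<in> B"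
        by (intro lin_closedD(2)[OF B(1)] lin_closedD(3)[OF B(1)] y cb)
      moreover have "\<forall>T\<in>\<Omega>. z T = (b T + z S / y S * y T) + (\<Sum>a\<in>A. c a * e a T)"
        using cb(2) by (simp add: algebra_simps)
      ultimately show ?thesis by (intro exI[of _ c] bexI) auto
    next
      case False
      then have SA: "S \<in> A" using S_lead A(2) by blast
      then obtain c b where cb: "b \<in> B"
        "\<forall>T\<in>\<Omega>. z T - z S / e S S * e S T = b T + (\<Sum>a\<in>A. c a * e a T)"
        using step[of "e S"] e by blast
      define c' where "c' = c(S := c S + z S / e S S)"
      have "(\<Sum>a\<in>A. c' a * e a T) = (\<Sum>a\<in>A. c a * e a T) + z S / e S S * e S T" for T
      proof -
        have "(\<Sum>a\<in>A. c' a * e a T)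
          = (\<Sum>a\<in>A. c a * e a T + (if a = S then z S / e S S * e S T else 0))"
          by (rule sum.cong) (auto simp: c'_def algebra_simps)
        then show ?thesis using A(1) SA by (simp add: sum.distrib)
      qed
      then have "\<forall>T\<in>\<Omega>. z T = b T + (\<Sum>a\<in>A. c' a * e a T)"
        using cb(2) by (auto simp: algebra_simps)
      then show ?thesis using cb(1) by blast
    qed
  qed
qed

lemma leads_reduce_finite:
  fixes Z B :: "('a \<Rightarrow> 'f::field) set" and e :: "'a \<Rightarrow> 'a \<Rightarrow> 'f"
  assumes "finite \<Omega>" "inj_on w \<Omega>" "lin_closed Z" "lin_closed B" "B \<subseteq> Z"
    "finite A" "leads \<Omega> w Z \<subseteq> leads \<Omega> w B \<union> A"
    "\<And>a. a \<in> A \<Longrightarrow> e a \<in> Z \<and> e a a \<noteq> 0 \<and> (\<forall>T\<in>\<Omega>. e a T \<noteq> 0 \<longrightarrow> w T \<le> w a)"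
    "z \<in> Z"
  shows "\<exists>c. \<exists>b\<in>B. \<forall>S\<in>\<Omega>. z S = b S + (\<Sum>a\<in>A. c a * e a S)"
proof (rule leads_reduce[OF assms(2-9)])
  show "w T < Suc (Max (w ` \<Omega>))" if "T \<in> \<Omega>" for T
    using assms(1) that by (simp add: less_Suc_eq_le)
qed auto

text \<open>Elimination with no extra pivots matches \<open>z\<close> with some
  \<open>b \<in> B\<close> on all of \<open>\<Omega>\<close>, and faithfulness makes them equal.
  This turns a count of leading positions into an equality of spaces.\<close>

lemma subset_of_leads_subset:
  fixes Z B :: "('a \<Rightarrow> 'f::field) set"
  assumes \<Omega>: "finite \<Omega>" "inj_on w \<Omega>" and Z: "lin_closed Z" and B: "lin_closed B" "B \<subseteq> Z"
    and faithful: "\<And>z. z \<in> Z \<Longrightarrow> \<forall>S\<in>\<Omega>. z S = 0 \<Longrightarrow> z = (\<lambda>S. 0)"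
    and leads: "leads \<Omega> w Z \<subseteq> leads \<Omega> w B"
  shows "Z \<subseteq> B"
proof
  fix z assume z: "z \<in> Z"
  then have "\<exists>b\<in>B. \<forall>S\<in>\<Omega>. z S = b S"
    using leads_reduce_finite[OF \<Omega> Z B finite.emptyI, of "\<lambda>_ _. 0" z] leads by simp
  then obtain b where b: "b \<in> B" "\<forall>S\<in>\<Omega>. z S = b S" by blast
  have "(\<lambda>S. z S - b S) = (\<lambda>S. 0)"
    using b B(2) z by (intro faithful lin_closedD(4)[OF Z]) auto
  then have "z = b" by (simp add: fun_eq_iff)
  then show "z \<in> B" using b by simp
qed

text \<open>Pick one element of \<open>Z\<close> for each pivot that \<open>B\<close> lacks. A
  nontrivial combination leads at its highest pivot with nonzero coefficient, so it cannot lie in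
  \<open>B\<close>; elimination shows that these elements span modulo \<open>B\<close>.\<close>

lemma dim_quotient_eq_card_leads:
  fixes Z B :: "('a \<Rightarrow> 'f::field) set"
  assumes \<Omega>: "finite \<Omega>" "inj_on w \<Omega>" and Z: "lin_closed Z" and B: "lin_closed B" "B \<subseteq> Z"
    and faithful: "\<And>z. z \<in> Z \<Longrightarrow> \<forall>S\<in>\<Omega>. z S = 0 \<Longrightarrow> z = (\<lambda>S. 0)"
  shows "vectorspace.dim (class_ring :: 'f ring) (quotient_module (fun_module Z) B)
    = card (leads \<Omega> w Z - leads \<Omega> w B)"
proof -
  define A where "A = leads \<Omega> w Z - leads \<Omega> w B"
  have A\<Omega>: "A \<subseteq> \<Omega>" unfolding A_def leads_def by blast
  then have finA: "finite A" using \<Omega>(1) by (rule finite_subset)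
  have "\<forall>a\<in>A. \<exists>y. y \<in> Z \<and> y a \<noteq> 0 \<and> (\<forall>T\<in>\<Omega>. y T \<noteq> 0 \<longrightarrow> w T \<le> w a)"
    unfolding A_def leads_def by blast
  then obtain e where e: "\<And>a. a \<in> A \<Longrightarrow>
      e a \<in> Z \<and> e a a \<noteq> 0 \<and> (\<forall>T\<in>\<Omega>. e a T \<noteq> 0 \<longrightarrow> w T \<le> w a)"
    by metis
  have "vectorspace.dim (class_ring :: 'f ring) (quotient_module (fun_module Z) B) = card A"
  proof (rule dim_quotient[OF Z B(1) finA])
    show "e a \<in> Z" if "a \<in> A" for a using e that by blast
  next
    fix c assume cB: "(\<lambda>x. \<Sum>a\<in>A. c a * e a x) \<in> B"
    show "\<forall>a\<in>A. c a = 0"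
    proof (rule ccontr)
      assume "\<not> ?thesis"
      then have ne: "{a \<in> A. c a \<noteq> 0} \<noteq> {}" by blast
      obtain a where a: "a \<in> A" "c a \<noteq> 0" and a_max: "\<And>b. b \<in> A \<Longrightarrow> c b \<noteq> 0 \<Longrightarrow> w b \<le> w a"
      proof -
        let ?M = "Max (w ` {a \<in> A. c a \<noteq> 0})"
        have "?M \<in> w ` {a \<in> A. c a \<noteq> 0}" using ne finA by (intro Max_in) auto
        then obtain a where "a \<in> A" "c a \<noteq> 0" "w a = ?M" by auto
        moreover have "w b \<le> ?M" if "b \<in> A" "c b \<noteq> 0" for b using that finA by (intro Max_ge) auto
        ultimately show ?thesis using that by metis
      qed
      have off: "c b * e b a = 0" if "b \<in> A - {a}" for b
      proof (rule ccontr)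
        assume "c b * e b a \<noteq> 0"
        then have "c b \<noteq> 0" "w a \<le> w b" using e[of b] that a A\<Omega> by auto
        then have "w a = w b" using a_max that by force
        then show False using that a A\<Omega> \<Omega>(2) by (auto dest: inj_onD)
      qed
      have "(\<Sum>b\<in>A. c b * e b a) = c a * e a a"
        using sum.mono_neutral_right[OF finA, of "{a}" "\<lambda>b. c b * e b a"] off a(1) by simp
      then have "(\<Sum>b\<in>A. c b * e b a) \<noteq> 0" using a e by simp
      moreover have "w T \<le> w a" if T: "T \<in> \<Omega>" "(\<Sum>b\<in>A. c b * e b T) \<noteq> 0" for T
      proof -
        obtain b where "b \<in> A" "c b * e b T \<noteq> 0" using sum.not_neutral_contains_not_neutral[OF T(2)] by blast
        then have "w T \<le> w b" "w b \<le> w a" using e a_max T(1) by auto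
        then show ?thesis by simp
      qed
      moreover have "a \<in> \<Omega>" using a(1) A\<Omega> by (rule subsetD[rotated])
      ultimately have "a \<in> leads \<Omega> w B"
        unfolding leads_def mem_Collect_eq by (intro conjI bexI[OF _ cB]) auto
      then show False using a(1) unfolding A_def by blast
    qed
  next
    fix z assume z: "z \<in> Z"
    have "leads \<Omega> w Z \<subseteq> leads \<Omega> w B \<union> A" unfolding A_def by blast
    from leads_reduce_finite[OF \<Omega> Z B finA this e z]
    obtain c b where cb: "b \<in> B" "\<forall>S\<in>\<Omega>. z S = b S + (\<Sum>a\<in>A. c a * e a S)" by blast
    let ?y = "\<lambda>x. z x - (\<Sum>a\<in>A. c a * e a x)"
    \<comment> \<open>Elimination controls values on \<open>\<Omega>\<close> only, so the difference
      with \<open>b\<close> must be seen to lie in \<open>Z\<close> before faithfulness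
      applies.\<close>
    have "?y \<in> Z" using e by (intro lin_closedD(4)[OF Z] lin_closed_sum[OF Z] z) auto
    then have "(\<lambda>x. ?y x - b x) \<in> Z" using lin_closedD(4)[OF Z, of ?y b] cb(1) B(2) by blast
    then have "(\<lambda>x. ?y x - b x) = (\<lambda>x. 0)" using cb(2) by (intro faithful) auto
    then have "?y = b" by (simp add: fun_eq_iff)
    with cb(1) have "?y \<in> B" by (simp only:)
    then show "\<exists>c. (\<lambda>x. z x - (\<Sum>a\<in>A. c a * e a x)) \<in> B" by (intro exI[of _ c])
  qed
  then show ?thesis unfolding A_def .
qed

section \<open>Chains, cycles and boundaries\<close>

text \<open>Chain spaces are indexed by the cardinality of the faces, one more than their dimension.\<close>

definition chain_space :: "nat set set \<Rightarrow> nat \<Rightarrow> (nat set \<Rightarrow> 'f::field) set" where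
  "chain_space K j = {c. \<forall>\<sigma>. \<not> (\<sigma> \<in> K \<and> card \<sigma> = j) \<longrightarrow> c \<sigma> = 0}"

text \<open>The boundary read off at \<open>\<tau>\<close> from its cofaces; the complex enters only
  through the support of \<open>c\<close>. Counting the vertices below \<open>v\<close> in
  \<open>\<tau>\<close> gives the position of \<open>v\<close> in
  \<open>insert v \<tau>\<close>.\<close>

definition bdry :: "nat \<Rightarrow> (nat set \<Rightarrow> 'f::field) \<Rightarrow> nat set \<Rightarrow> 'f" where
  "bdry m c \<tau> = (\<Sum>v\<in>{1..m} - \<tau>. (- 1) ^ card {w \<in> \<tau>. w < v} * c (insert v \<tau>))"

definition cycle_space :: "nat \<Rightarrow> nat set set \<Rightarrow> nat \<Rightarrow> (nat set \<Rightarrow> 'f::field) set" where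
  "cycle_space m K j = {c \<in> chain_space K j. bdry m c = (\<lambda>\<tau>. 0)}"

definition boundary_space :: "nat \<Rightarrow> nat set set \<Rightarrow> nat \<Rightarrow> (nat set \<Rightarrow> 'f::field) set" where
  "boundary_space m K j = bdry m ` chain_space K (Suc j)"

lemma chain_space_nonzeroD: "c \<in> chain_space K j \<Longrightarrow> c \<sigma> \<noteq> 0 \<Longrightarrow> \<sigma> \<in> K \<and> card \<sigma> = j"
  unfolding chain_space_def by blast

lemma chain_space_mono: "(\<And>\<sigma>. \<sigma> \<in> K \<Longrightarrow> card \<sigma> = j \<Longrightarrow> \<sigma> \<in> L) \<Longrightarrow> chain_space K j \<subseteq> chain_space L j"
  unfolding chain_space_def by blast

lemma cycle_space_mono: "(\<And>\<sigma>. \<sigma> \<in> K \<Longrightarrow> card \<sigma> = j \<Longrightarrow> \<sigma> \<in> L) \<Longrightarrow> cycle_space m K j \<subseteq> cycle_space m L j"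
  unfolding cycle_space_def using chain_space_mono[of K j L] by blast

lemma boundary_space_mono: "(\<And>\<sigma>. \<sigma> \<in> K \<Longrightarrow> card \<sigma> = Suc j \<Longrightarrow> \<sigma> \<in> L) \<Longrightarrow> boundary_space m K j \<subseteq> boundary_space m L j"
  unfolding boundary_space_def by (intro image_mono chain_space_mono)

lemma faces_card: "faces K (int j - 1) = {\<sigma> \<in> K. card \<sigma> = j}"
  by (auto simp: faces_def simplex_dim_def)

lemma boundary_eq_bdry:
  fixes c :: "nat set \<Rightarrow> 'f::field"
  assumes K: "K \<subseteq> Pow {1..m}" and c: "c \<in> chain_space K j"
  shows "boundary K (int j - 1) c = bdry m c"
proof
  fix \<tau> :: "nat set"
  let ?F = "{\<sigma> \<in> K. card \<sigma> = j}"
  let ?s = "\<lambda>v. (- 1) ^ card {w \<in> \<tau>. w < v} :: 'f"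
  have fin: "finite ?F" using finite_subset[of ?F "Pow {1..m}"] K by auto
  have c0: "c \<sigma> = 0" if "\<sigma> \<notin> ?F" for \<sigma> using c that unfolding chain_space_def by blast
  have "boundary K (int j - 1) c \<tau> = (\<Sum>\<sigma>\<in>?F. \<Sum>v\<in>{1..m}. if v \<in> \<sigma> \<and> \<tau> = \<sigma> - {v} then ?s v * c \<sigma> else 0)"
    unfolding boundary_def faces_card
  proof (rule sum.cong[OF refl])
    fix \<sigma> assume "\<sigma> \<in> ?F"
    then have \<sigma>: "\<sigma> \<subseteq> {1..m}" using K by blast
    have "(\<Sum>v\<in>\<sigma>. if \<tau> = \<sigma> - {v} then (- 1) ^ card {w \<in> \<sigma>. w < v} * c \<sigma> else 0)
      = (\<Sum>v\<in>\<sigma>. if v \<in> \<sigma> \<and> \<tau> = \<sigma> - {v} then ?s v * c \<sigma> else 0)"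
    proof (rule sum.cong[OF refl])
      fix v assume "v \<in> \<sigma>"
      moreover have "{w \<in> \<sigma>. w < v} = {w \<in> \<sigma> - {v}. w < v}" by auto
      ultimately show "(if \<tau> = \<sigma> - {v} then (- 1) ^ card {w \<in> \<sigma>. w < v} * c \<sigma> else 0)
        = (if v \<in> \<sigma> \<and> \<tau> = \<sigma> - {v} then ?s v * c \<sigma> else 0)" by simp
    qed
    also have "\<dots> = (\<Sum>v\<in>{1..m}. if v \<in> \<sigma> \<and> \<tau> = \<sigma> - {v} then ?s v * c \<sigma> else 0)"
      using \<sigma> by (intro sum.mono_neutral_left) auto
    finally show "(\<Sum>v\<in>\<sigma>. if \<tau> = \<sigma> - {v} then (- 1) ^ card {w \<in> \<sigma>. w < v} * c \<sigma> else 0)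
      = (\<Sum>v\<in>{1..m}. if v \<in> \<sigma> \<and> \<tau> = \<sigma> - {v} then ?s v * c \<sigma> else 0)" .
  qed
  also have "\<dots> = (\<Sum>v\<in>{1..m}. \<Sum>\<sigma>\<in>?F. if v \<in> \<sigma> \<and> \<tau> = \<sigma> - {v} then ?s v * c \<sigma> else 0)"
    by (rule sum.swap)
  \<comment> \<open>For a fixed removed vertex \<open>v\<close>, the only face that can contribute
    is \<open>insert v \<tau>\<close>.\<close>
  also have "\<dots> = (\<Sum>v\<in>{1..m}. if v \<notin> \<tau> then ?s v * c (insert v \<tau>) else 0)"
  proof (rule sum.cong[OF refl])
    fix v
    have "(\<Sum>\<sigma>\<in>?F. if v \<in> \<sigma> \<and> \<tau> = \<sigma> - {v} then ?s v * c \<sigma> else 0)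
      = (\<Sum>\<sigma>\<in>?F. if \<sigma> = insert v \<tau> then (if v \<notin> \<tau> then ?s v * c (insert v \<tau>) else 0) else 0)"
    proof (rule sum.cong[OF refl])
      fix \<sigma>
      have "v \<in> \<sigma> \<and> \<tau> = \<sigma> - {v} \<longleftrightarrow> v \<notin> \<tau> \<and> \<sigma> = insert v \<tau>" by blast
      then show "(if v \<in> \<sigma> \<and> \<tau> = \<sigma> - {v} then ?s v * c \<sigma> else 0)
        = (if \<sigma> = insert v \<tau> then (if v \<notin> \<tau> then ?s v * c (insert v \<tau>) else 0) else 0)"
        by (simp only: split: if_split) blast
    qed
    also have "\<dots> = (if v \<notin> \<tau> then ?s v * c (insert v \<tau>) else 0)"
      using fin c0[of "insert v \<tau>"] by simp
    finally show "(\<Sum>\<sigma>\<in>?F. if v \<in> \<sigma> \<and> \<tau> = \<sigma> - {v} then ?s v * c \<sigma> else 0)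
      = (if v \<notin> \<tau> then ?s v * c (insert v \<tau>) else 0)" .
  qed
  also have "\<dots> = bdry m c \<tau>"
    unfolding bdry_def by (rule sum.mono_neutral_cong_right) auto
  finally show "boundary K (int j - 1) c \<tau> = bdry m c \<tau>" .
qed

lemma carrier_chain_module: "carrier (chain_module K (int j - 1)) = chain_space K j"
  unfolding chain_module_def faces_card chain_space_def by simp

lemma cycles_eq_cycle_space:
  assumes "K \<subseteq> Pow {1..m}"
  shows "cycles K (int j - 1) = cycle_space m K j"
  unfolding cycles_def cycle_space_def carrier_chain_module
  by (auto simp: boundary_eq_bdry[OF assms])

lemma boundaries_eq_boundary_space:
  assumes "K \<subseteq> Pow {1..m}"
  shows "boundaries K (int j - 1) = boundary_space m K j"
proof -
  have j: "int j - 1 + 1 = int (Suc j) - 1" by simp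
  show ?thesis
    unfolding boundaries_def boundary_space_def j carrier_chain_module
    by (rule image_cong[OF refl boundary_eq_bdry[OF assms]])
qed

lemma reduced_betti_eq_dim:
  assumes "K \<subseteq> Pow {1..m}"
  shows "reduced_betti TYPE('f::field) K (int j - 1) =
    vectorspace.dim (class_ring :: 'f ring) (quotient_module (fun_module (cycle_space m K j)) (boundary_space m K j))"
proof -
  have "(chain_module K (int j - 1))\<lparr>carrier := cycle_space m K j\<rparr> = (fun_module (cycle_space m K j) :: ('f, _) module)"
    by (simp add: chain_module_def fun_module_def)
  then show ?thesis
    unfolding reduced_betti_def reduced_homology_def
    by (simp add: cycles_eq_cycle_space[OF assms] boundaries_eq_boundary_space[OF assms])
qed

lemma bdry_add: "bdry m (\<lambda>\<sigma>. y \<sigma> + z \<sigma>) = (\<lambda>\<tau>. bdry m y \<tau> + bdry m z \<tau>)"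
  by (rule ext) (simp add: bdry_def algebra_simps sum.distrib)

lemma bdry_scale: "bdry m (\<lambda>\<sigma>. a * z \<sigma>) = (\<lambda>\<tau>. a * bdry m z \<tau>)"
  by (rule ext) (simp add: bdry_def algebra_simps sum_distrib_left)

lemma bdry_zero: "bdry m (\<lambda>\<sigma>. 0) = (\<lambda>\<tau>. 0)"
  by (rule ext) (simp add: bdry_def)

lemma lin_closed_chain_space: "lin_closed (chain_space K j)"
  by (rule lin_closedI) (auto simp: chain_space_def)

lemma lin_closed_cycle_space: "lin_closed (cycle_space m K j)"
  by (rule lin_closedI)
    (auto simp: cycle_space_def chain_space_def bdry_zero bdry_add bdry_scale)

lemma lin_closed_boundary_space: "lin_closed (boundary_space m K j)"
proof (rule lin_closedI)
  show "(\<lambda>x. 0) \<in> boundary_space m K j"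
    using imageI[OF lin_closedD(1)[OF lin_closed_chain_space], of "bdry m" K "Suc j"]
    by (simp only: bdry_zero boundary_space_def)
next
  fix y z :: "nat set \<Rightarrow> 'a" assume "y \<in> boundary_space m K j" "z \<in> boundary_space m K j"
  then obtain y' z' where yz: "y' \<in> chain_space K (Suc j)" "y = bdry m y'"
      "z' \<in> chain_space K (Suc j)" "z = bdry m z'"
    unfolding boundary_space_def by blast
  show "(\<lambda>x. y x + z x) \<in> boundary_space m K j"
    using imageI[OF lin_closedD(2)[OF lin_closed_chain_space yz(1,3)], of "bdry m"]
    by (simp only: bdry_add yz boundary_space_def)
next
  fix a and z :: "nat set \<Rightarrow> 'a" assume "z \<in> boundary_space m K j"
  then obtain z' where z: "z' \<in> chain_space K (Suc j)" "z = bdry m z'"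
    unfolding boundary_space_def by blast
  show "(\<lambda>x. a * z x) \<in> boundary_space m K j"
    using imageI[OF lin_closedD(3)[OF lin_closed_chain_space z(1)], of "bdry m" a]
    by (simp only: bdry_scale z boundary_space_def)
qed

text \<open>Inserting the smaller of two vertices shifts the position of the larger one. The two
  orders of insertion therefore contribute opposite signs and cancel after renaming.\<close>

lemma bdry_bdry: "bdry m (bdry m c) = (\<lambda>\<tau>. 0 :: 'f::field)"
proof
  fix \<tau> :: "nat set"
  let ?X = "{1..m} - \<tau>"
  let ?s = "\<lambda>v. (- 1) ^ card {w \<in> \<tau>. w < v} :: 'f"
  let ?g = "\<lambda>v u. ?s v * ?s u * c (insert u (insert v \<tau>))"
  have sgn: "(- 1) ^ card {w \<in> insert v \<tau>. w < u} = (if v < u then - ?s u else ?s u)"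
    if "v \<in> ?X" for v u
  proof (cases "v < u")
    case True
    then have "{w \<in> insert v \<tau>. w < u} = insert v {w \<in> \<tau>. w < u}" by auto
    then show ?thesis using that True by simp
  next
    case False
    then have "{w \<in> insert v \<tau>. w < u} = {w \<in> \<tau>. w < u}" by auto
    then show ?thesis using False by simp
  qed
  have "bdry m (bdry m c) \<tau> = (\<Sum>v\<in>?X. \<Sum>u\<in>?X - {v}. if v < u then - ?g v u else ?g v u)"
    unfolding bdry_def
  proof (rule sum.cong[OF refl])
    fix v assume v: "v \<in> ?X"
    have "{1..m} - insert v \<tau> = ?X - {v}" by blast
    then show "?s v * (\<Sum>u\<in>{1..m} - insert v \<tau>. (- 1) ^ card {w \<in> insert v \<tau>. w < u} * c (insert u (insert v \<tau>)))
      = (\<Sum>u\<in>?X - {v}. if v < u then - ?g v u else ?g v u)"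
      unfolding sum_distrib_left using sgn[OF v] by (intro sum.cong) auto
  qed
  also have "\<dots> = (\<Sum>v\<in>?X. (\<Sum>u\<in>{u \<in> ?X. u < v}. ?g v u) - (\<Sum>u\<in>{u \<in> ?X. v < u}. ?g v u))"
  proof (rule sum.cong[OF refl])
    fix v assume v: "v \<in> ?X"
    have split: "?X - {v} = {u \<in> ?X. u < v} \<union> {u \<in> ?X. v < u}" by auto
    show "(\<Sum>u\<in>?X - {v}. if v < u then - ?g v u else ?g v u)
      = (\<Sum>u\<in>{u \<in> ?X. u < v}. ?g v u) - (\<Sum>u\<in>{u \<in> ?X. v < u}. ?g v u)"
      unfolding split by (subst sum.union_disjoint) (auto simp: sum_negf)
  qed
  also have "\<dots> = (\<Sum>v\<in>?X. \<Sum>u\<in>{u \<in> ?X. u < v}. ?g v u) - (\<Sum>v\<in>?X. \<Sum>u\<in>{u \<in> ?X. v < u}. ?g v u)"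
    by (rule sum_subtractf)
  also have "(\<Sum>v\<in>?X. \<Sum>u\<in>{u \<in> ?X. v < u}. ?g v u) = (\<Sum>u\<in>?X. \<Sum>v\<in>{v \<in> ?X. v < u}. ?g v u)"
    by (rule sum.swap_restrict) auto
  also have "\<dots> = (\<Sum>v\<in>?X. \<Sum>u\<in>{u \<in> ?X. u < v}. ?g v u)"
    by (simp add: insert_commute mult.commute)
  finally show "bdry m (bdry m c) \<tau> = 0" by simp
qed

section \<open>Boundaries of single faces\<close>

definition unit_chain :: "'a \<Rightarrow> 'a \<Rightarrow> 'f::field" where
  "unit_chain T = (\<lambda>x. if x = T then 1 else 0)"

lemma unit_chain_in_chain_space: "T \<in> K \<Longrightarrow> unit_chain T \<in> chain_space K (card T)"
  by (simp add: unit_chain_def chain_space_def)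

lemma bdry_unit_chain_facet:
  assumes "T \<subseteq> {1..m}" "v \<in> T"
  shows "bdry m (unit_chain T :: nat set \<Rightarrow> 'f::field) (T - {v}) \<noteq> 0"
proof -
  let ?s = "(- 1) ^ card {w \<in> T - {v}. w < v} :: 'f"
  have "bdry m (unit_chain T :: nat set \<Rightarrow> 'f) (T - {v}) = (\<Sum>u\<in>{v}. ?s)"
    unfolding bdry_def
  proof (rule sum.mono_neutral_cong_right)
    show "\<forall>u\<in>{1..m} - (T - {v}) - {v}. (- 1) ^ card {w \<in> T - {v}. w < u} * unit_chain T (insert u (T - {v})) = (0::'f)"
      by (auto simp: unit_chain_def)
  qed (use assms in \<open>auto simp: unit_chain_def insert_absorb\<close>)
  then show ?thesis by simp
qed

lemma bdry_unit_chain_nonzeroD: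
  assumes "bdry m (unit_chain T :: nat set \<Rightarrow> 'f::field) \<tau> \<noteq> 0"
  shows "\<exists>v\<in>T. \<tau> = T - {v}"
proof -
  obtain v where "v \<in> {1..m} - \<tau>" "(- 1) ^ card {w \<in> \<tau>. w < v} * (unit_chain T (insert v \<tau>) :: 'f) \<noteq> 0"
    using sum.not_neutral_contains_not_neutral[OF assms[unfolded bdry_def]] by blast
  then have "T = insert v \<tau>" "v \<notin> \<tau>" by (auto simp: unit_chain_def split: if_splits)
  then show ?thesis by auto
qed

lemma boundary_space_subset_cycle_space:
  assumes K: "K \<subseteq> Pow {1..m}" "\<And>\<sigma> \<tau>. \<sigma> \<in> K \<Longrightarrow> \<tau> \<subseteq> \<sigma> \<Longrightarrow> \<tau> \<in> K"
  shows "(boundary_space m K j :: (nat set \<Rightarrow> 'f::field) set) \<subseteq> cycle_space m K j"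
proof
  fix z :: "nat set \<Rightarrow> 'f" assume "z \<in> boundary_space m K j"
  then obtain y where y: "y \<in> chain_space K (Suc j)" "z = bdry m y" unfolding boundary_space_def by blast
  have "\<tau> \<in> K \<and> card \<tau> = j" if "z \<tau> \<noteq> 0" for \<tau>
  proof -
    have "bdry m y \<tau> \<noteq> 0" using that y(2) by simp
    then obtain v where v: "v \<in> {1..m} - \<tau>" "(- 1) ^ card {w \<in> \<tau>. w < v} * y (insert v \<tau>) \<noteq> 0"
      unfolding bdry_def using sum.not_neutral_contains_not_neutral by blast
    then have *: "insert v \<tau> \<in> K" "card (insert v \<tau>) = Suc j"
      using chain_space_nonzeroD[OF y(1), of "insert v \<tau>"] by auto
    have "finite (insert v \<tau>)" using *(1) K(1) by (meson PowD finite_atLeastAtMost finite_subset subsetD)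
    then show ?thesis using * v(1) K(2)[OF *(1), of \<tau>] by auto
  qed
  then have "z \<in> chain_space K j" unfolding chain_space_def by blast
  then show "z \<in> cycle_space m K j" using y(2) by (simp add: cycle_space_def bdry_bdry)
qed

section \<open>Critical sets\<close>

text \<open>\<open>set_encode\<close> is the sum of the powers \<open>2 ^ v\<close>, so inserting a
  common new vertex adds the same amount to two codes and preserves their order.\<close>

abbreviation ld :: "nat \<Rightarrow> nat \<Rightarrow> (nat set \<Rightarrow> 'f::field) set \<Rightarrow> nat set set" where
  "ld m p \<equiv> leads (Pow ({1..m} - {p})) set_encode"

lemma finite_Pow_vertices: "finite (Pow ({1..m} - {p :: nat}))"
  by simp

lemma inj_on_set_encode_vertices: "inj_on set_encode (Pow ({1..m} - {p}))"
  by (rule inj_on_subset[OF inj_on_set_encode]) (auto intro: finite_subset)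

text \<open>If \<open>z\<close> vanishes on sets avoiding \<open>p\<close>, then among the cofaces
  of \<open>T - {p}\<close> only \<open>T\<close> contributes, and the vanishing boundary there
  reads \<open>z T = 0\<close> up to sign.\<close>

lemma cycle_space_faithful:
  fixes z :: "nat set \<Rightarrow> 'f::field"
  assumes K: "K \<subseteq> Pow {1..m}" and p: "p \<in> {1..m}"
    and z: "z \<in> cycle_space m K j" "\<forall>S\<in>Pow ({1..m} - {p}). z S = 0"
  shows "z = (\<lambda>S. 0)"
proof (rule ext, rule ccontr)
  fix T assume T: "z T \<noteq> 0"
  have zc: "z \<in> chain_space K j" and bz: "bdry m z = (\<lambda>\<tau>. 0)"
    using z(1) unfolding cycle_space_def by auto
  have TK: "T \<subseteq> {1..m}" using chain_space_nonzeroD[OF zc T] K by blast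
  then have pT: "p \<in> T" using T z(2) by blast
  have "bdry m z (T - {p}) = (\<Sum>v\<in>{p}. (- 1) ^ card {w \<in> T - {p}. w < v} * z T)"
    unfolding bdry_def
  proof (rule sum.mono_neutral_cong_right)
    show "\<forall>v\<in>{1..m} - (T - {p}) - {p}.
        (- 1) ^ card {w \<in> T - {p}. w < v} * z (insert v (T - {p})) = 0"
      using z(2) TK by auto
  qed (use p pT in \<open>auto simp: insert_absorb\<close>)
  then show False using T bz by simp
qed

lemma ld_nonzero:
  assumes "S \<in> ld m p W" "W \<subseteq> chain_space K j"
  shows "S \<in> K" "card S = j" "S \<subseteq> {1..m} - {p}"
  using assms chain_space_nonzeroD unfolding leads_def by blast+

lemma cycle_space_subset_chain_space: "cycle_space m K j \<subseteq> chain_space K j"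
  unfolding cycle_space_def by blast

text \<open>If \<open>S\<close> leads the cycle \<open>z\<close>, then \<open>S - {v}\<close> leads the boundary of the part of \<open>z\<close> supported
  on the faces containing \<open>v\<close>.\<close>

lemma facet_of_lead_in_ld_boundary_space:
  assumes S: "S \<in> ld m p (cycle_space m K (Suc i) :: (nat set \<Rightarrow> 'f::field) set)" and v: "v \<in> S"
  shows "S - {v} \<in> ld m p (boundary_space m K i :: (nat set \<Rightarrow> 'f) set)"
proof -
  obtain z :: "nat set \<Rightarrow> 'f" where z: "z \<in> chain_space K (Suc i)" "bdry m z = (\<lambda>\<tau>. 0)"
    and zS: "z S \<noteq> 0" and max: "\<And>T. T \<subseteq> {1..m} - {p} \<Longrightarrow> z T \<noteq> 0 \<Longrightarrow> set_encode T \<le> set_encode S"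
    and SX: "S \<subseteq> {1..m} - {p}"
    using S unfolding leads_def cycle_space_def by blast
  define y where "y T = (if v \<in> T then z T else 0)" for T
  have yc: "y \<in> chain_space K (Suc i)" using z(1) unfolding y_def chain_space_def by auto
  have vm: "v \<in> {1..m} - {p}" using v SX by blast
  \<comment> \<open>If \<open>v \<in> \<tau>\<close>, all cofaces of \<open>\<tau>\<close> contain
    \<open>v\<close>, so truncation changes nothing there; if \<open>v\<close> is not in
    \<open>\<tau>\<close>, only \<open>insert v \<tau>\<close> survives truncation.\<close>
  have b_in: "bdry m y \<tau> = 0" if "v \<in> \<tau>" for \<tau>
  proof -
    have "bdry m y \<tau> = bdry m z \<tau>" using that unfolding bdry_def y_def by simp
    then show ?thesis using z(2) by simp
  qed
  have b_out: "bdry m y \<tau> = (- 1) ^ card {w \<in> \<tau>. w < v} * z (insert v \<tau>)" if "v \<notin> \<tau>" for \<tau>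
  proof -
    have "bdry m y \<tau> = (\<Sum>u\<in>{v}. (- 1) ^ card {w \<in> \<tau>. w < u} * z (insert u \<tau>))"
      unfolding bdry_def by (rule sum.mono_neutral_cong_right) (use that vm in \<open>auto simp: y_def\<close>)
    then show ?thesis by simp
  qed
  have enc: "set_encode (insert v T) = 2 ^ v + set_encode T" if "T \<subseteq> {1..m}" "v \<notin> T" for T
    using that finite_subset[of T "{1..m}"] by simp
  have "bdry m y (S - {v}) \<noteq> 0" using b_out[of "S - {v}"] zS v by (simp add: insert_absorb)
  moreover have "set_encode T \<le> set_encode (S - {v})"
    if T: "T \<subseteq> {1..m} - {p}" "bdry m y T \<noteq> 0" for T
  proof -
    have vT: "v \<notin> T" using b_in T(2) by blast
    then have "z (insert v T) \<noteq> 0" using b_out[OF vT] T(2) by auto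
    then have "set_encode (insert v T) \<le> set_encode S" using T(1) vm by (intro max) auto
    moreover have "set_encode S = 2 ^ v + set_encode (S - {v})"
      using enc[of "S - {v}"] SX v by (auto simp: insert_absorb)
    moreover have "T \<subseteq> {1..m}" using T(1) by blast
    ultimately show ?thesis using enc[OF _ vT] by simp
  qed
  ultimately show ?thesis
    unfolding leads_def boundary_space_def using yc SX by auto
qed

text \<open>In the boundary of the face \<open>insert p S\<close>, the set \<open>S\<close> is the
  only facet avoiding \<open>p\<close>, so it leads whatever the order.\<close>

lemma in_ld_boundary_space:
  assumes S: "S \<subseteq> {1..m} - {p}" and p: "p \<in> {1..m}" and K: "insert p S \<in> K"
  shows "S \<in> ld m p (boundary_space m K (card S) :: (nat set \<Rightarrow> 'f::field) set)"
proof -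
  let ?y = "bdry m (unit_chain (insert p S)) :: nat set \<Rightarrow> 'f"
  have "finite S" using S finite_subset by blast
  moreover have "p \<notin> S" using S by blast
  ultimately have "card (insert p S) = Suc (card S)" by simp
  then have "?y \<in> boundary_space m K (card S)"
    unfolding boundary_space_def using unit_chain_in_chain_space[OF K] by (metis imageI)
  moreover have "insert p S - {p} = S" using S by blast
  then have "?y S \<noteq> 0" using bdry_unit_chain_facet[of "insert p S" m p] S p by auto
  moreover have "T = S" if T: "T \<in> Pow ({1..m} - {p})" "?y T \<noteq> 0" for T
  proof -
    obtain v where "v \<in> insert p S" "T = insert p S - {v}" using bdry_unit_chain_nonzeroD[OF T(2)] by blast
    then show ?thesis using T(1) S by blast
  qed
  ultimately show ?thesis unfolding leads_def using S by blast
qed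

text \<open>All homological degrees are collected in one family, the size of \<open>S\<close>
  selecting the chain space; this lets sets of different degrees be compared by inclusion.\<close>

definition critical :: "'f::field itself \<Rightarrow> nat \<Rightarrow> nat \<Rightarrow> nat set set \<Rightarrow> nat set set" where
  "critical F m p K = {S. S \<in> ld m p (cycle_space m K (card S) :: (nat set \<Rightarrow> 'f) set) \<and>
     S \<notin> ld m p (boundary_space m K (card S) :: (nat set \<Rightarrow> 'f) set)}"

lemma simplicial_complexD:
  assumes "simplicial_complex_on m K"
  shows "K \<subseteq> Pow {1..m}" "{} \<in> K" "i \<in> {1..m} \<Longrightarrow> {i} \<in> K" "\<sigma> \<in> K \<Longrightarrow> \<tau> \<subseteq> \<sigma> \<Longrightarrow> \<tau> \<in> K"
    "\<sigma> \<in> K \<Longrightarrow> finite \<sigma>" "finite K"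
  using assms finite_subset[of _ "{1..m}"] finite_subset[of K "Pow {1..m}"]
  unfolding simplicial_complex_on_def by auto

lemma ld_boundary_subset_ld_cycle:
  assumes "simplicial_complex_on m K"
  shows "ld m p (boundary_space m K j :: (nat set \<Rightarrow> 'f::field) set)
    \<subseteq> ld m p (cycle_space m K j :: (nat set \<Rightarrow> 'f) set)"
  by (intro leads_mono boundary_space_subset_cycle_space)
    (use simplicial_complexD[OF assms] in auto)

lemma reduced_betti_eq_card_critical:
  assumes K: "simplicial_complex_on m K" and p: "p \<in> {1..m}"
  shows "reduced_betti TYPE('f::field) K (int j - 1) = card {S \<in> critical TYPE('f) m p K. card S = j}"
proof -
  note Ks = simplicial_complexD[OF K]
  have "reduced_betti TYPE('f) K (int j - 1) = card (ld m p (cycle_space m K j :: (nat set \<Rightarrow> 'f) set)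
      - ld m p (boundary_space m K j :: (nat set \<Rightarrow> 'f) set))"
    unfolding reduced_betti_eq_dim[OF Ks(1)]
  proof (rule dim_quotient_eq_card_leads[OF finite_Pow_vertices inj_on_set_encode_vertices
        lin_closed_cycle_space lin_closed_boundary_space])
    show "boundary_space m K j \<subseteq> (cycle_space m K j :: (nat set \<Rightarrow> 'f) set)"
      using Ks by (intro boundary_space_subset_cycle_space) auto
  qed (rule cycle_space_faithful[OF Ks(1) p])
  also have "ld m p (cycle_space m K j :: (nat set \<Rightarrow> 'f) set) - ld m p (boundary_space m K j :: (nat set \<Rightarrow> 'f) set)
      = {S \<in> critical TYPE('f) m p K. card S = j}"
    using ld_nonzero(2)[OF _ cycle_space_subset_chain_space] unfolding critical_def by blast
  finally show ?thesis .
qed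

lemma critical_memD:
  assumes "S \<in> critical TYPE('f::field) m p K"
  shows "S \<in> K" "S \<subseteq> {1..m} - {p}"
  using assms ld_nonzero[OF _ cycle_space_subset_chain_space, of S m p]
  unfolding critical_def by blast+

lemma complex_dim_iff:
  assumes K: "simplicial_complex_on m K"
  shows "complex_dim K = int d \<longleftrightarrow> (\<forall>\<sigma>\<in>K. card \<sigma> \<le> d + 1) \<and> (\<exists>\<sigma>\<in>K. card \<sigma> = d + 1)"
proof -
  have fin: "finite (simplex_dim ` K)" and ne: "simplex_dim ` K \<noteq> {}"
    using simplicial_complexD[OF K] by auto
  have "complex_dim K = int d \<longleftrightarrow> int d \<in> simplex_dim ` K \<and> (\<forall>x\<in>simplex_dim ` K. x \<le> int d)"
    unfolding complex_dim_def using Max_eq_iff[OF fin ne] by auto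
  also have "\<dots> \<longleftrightarrow> (\<forall>\<sigma>\<in>K. card \<sigma> \<le> d + 1) \<and> (\<exists>\<sigma>\<in>K. card \<sigma> = d + 1)"
  proof -
    have "simplex_dim \<sigma> = int d \<longleftrightarrow> card \<sigma> = d + 1" "simplex_dim \<sigma> \<le> int d \<longleftrightarrow> card \<sigma> \<le> d + 1" for \<sigma>
      by (auto simp: simplex_dim_def)
    then show ?thesis by (auto simp: image_iff) metis+
  qed
  finally show ?thesis .
qed

lemma total_reduced_betti_eq_card_critical:
  assumes K: "simplicial_complex_on m K" and p: "p \<in> {1..m}" and d: "complex_dim K = int d"
  shows "total_reduced_betti TYPE('f::field) K = card (critical TYPE('f) m p K)"
proof -
  let ?C = "critical TYPE('f) m p K"
  have fin: "finite ?C" using critical_memD(1) simplicial_complexD(6)[OF K] by (metis finite_subset subsetI)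
  have le: "card S \<le> d + 1" if "S \<in> ?C" for S
    using critical_memD(1)[OF that] d unfolding complex_dim_iff[OF K] by blast
  \<comment> \<open>Degree \<open>i\<close> corresponds to faces of size \<open>i + 1\<close>,
    starting with the empty face in degree -1.\<close>
  have range: "{-1..int d} = (\<lambda>j. int j - 1) ` {..d + 1}"
  proof -
    have "i \<in> (\<lambda>j. int j - 1) ` {..d + 1}" if "i \<in> {-1..int d}" for i
      using that by (intro image_eqI[of _ _ "nat (i + 1)"]) auto
    then show ?thesis by auto
  qed
  have "total_reduced_betti TYPE('f) K = (\<Sum>j\<le>d + 1. reduced_betti TYPE('f) K (int j - 1))"
    unfolding total_reduced_betti_def d range by (subst sum.reindex) (auto simp: inj_on_def)
  also have "\<dots> = (\<Sum>j\<le>d + 1. card {S \<in> ?C. card S = j})"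
    by (simp only: reduced_betti_eq_card_critical[OF K p])
  also have "\<dots> = card (\<Union>j\<in>{..d + 1}. {S \<in> ?C. card S = j})"
    using fin by (subst card_UN_disjoint) auto
  also have "(\<Union>j\<in>{..d + 1}. {S \<in> ?C. card S = j}) = ?C" using le by auto
  finally show ?thesis .
qed

text \<open>Removing a vertex from a lead of cycles gives a lead of boundaries. Boundaries are
  cycles, so the removal can be iterated down to \<open>T\<close>.\<close>

lemma proper_subset_of_lead_in_ld_boundary_space:
  assumes K: "simplicial_complex_on m K"
    and S: "S \<in> ld m p (cycle_space m K (card S) :: (nat set \<Rightarrow> 'f::field) set)" and T: "T \<subset> S"
  shows "T \<in> ld m p (boundary_space m K (card T) :: (nat set \<Rightarrow> 'f) set)"
  using S T
proof (induction "card S" arbitrary: S)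
  case 0
  then have "finite S" using ld_nonzero(3)[OF 0(2) cycle_space_subset_chain_space] finite_subset by blast
  then show ?case using 0 by simp
next
  case (Suc i)
  then obtain v where v: "v \<in> S" "v \<notin> T" by blast
  have cS: "card (S - {v}) = i" using Suc(2) v(1) by simp
  have *: "S - {v} \<in> ld m p (boundary_space m K i :: (nat set \<Rightarrow> 'f) set)"
    using facet_of_lead_in_ld_boundary_space[of S m p K i v] Suc.prems(1) Suc(2) v(1) by simp
  show ?case
  proof (cases "T = S - {v}")
    case True
    then show ?thesis using * cS by simp
  next
    case False
    then have "T \<subset> S - {v}" using Suc.prems(2) v(2) by blast
    moreover have "S - {v} \<in> ld m p (cycle_space m K i :: (nat set \<Rightarrow> 'f) set)"
      using * ld_boundary_subset_ld_cycle[OF K] by blast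
    ultimately show ?thesis using Suc(1)[of "S - {v}"] cS by simp
  qed
qed

lemma critical_incomparable:
  assumes K: "simplicial_complex_on m K"
    and "S \<in> critical TYPE('f::field) m p K" "T \<in> critical TYPE('f) m p K" "T \<subseteq> S"
  shows "T = S"
  using assms proper_subset_of_lead_in_ld_boundary_space[OF K, of S p T] unfolding critical_def by blast

text \<open>The face \<open>\<sigma>\<close> is a cone with apex \<open>p\<close>: for
  \<open>S \<subseteq> \<sigma> - {p}\<close> the set \<open>insert p S\<close> is a face, and its
  boundary is led by \<open>S\<close>.\<close>

lemma critical_avoids_face:
  assumes K: "simplicial_complex_on m K" and \<sigma>: "\<sigma> \<in> K" "p \<in> \<sigma>"
  shows "critical TYPE('f::field) m p K \<subseteq> Pow ({1..m} - {p}) - Pow (\<sigma> - {p})"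
proof
  fix S assume S: "S \<in> critical TYPE('f) m p K"
  have SX: "S \<subseteq> {1..m} - {p}" by (rule critical_memD(2)[OF S])
  have "\<not> S \<subseteq> \<sigma> - {p}"
  proof
    assume "S \<subseteq> \<sigma> - {p}"
    then have "insert p S \<in> K" using simplicial_complexD(4)[OF K \<sigma>(1)] \<sigma>(2) by blast
    moreover have "p \<in> {1..m}" using simplicial_complexD(1)[OF K] \<sigma> by blast
    ultimately have "S \<in> ld m p (boundary_space m K (card S) :: (nat set \<Rightarrow> 'f) set)"
      using SX by (intro in_ld_boundary_space) auto
    then show False using S unfolding critical_def by blast
  qed
  then show "S \<in> Pow ({1..m} - {p}) - Pow (\<sigma> - {p})" using SX by blast
qed

text \<open>Here \<open>h\<close> bounds cardinalities, so the skeleton has dimension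
  \<open>h - 1\<close>. Leaving \<open>\<sigma>\<close> arbitrary reduces closure under isomorphism
  to a choice of \<open>\<sigma>\<close>.\<close>

definition skeleton_union_face :: "nat \<Rightarrow> nat \<Rightarrow> nat set \<Rightarrow> nat set set" where
  "skeleton_union_face m h \<sigma> = {\<tau>. \<tau> \<subseteq> {1..m} \<and> card \<tau> \<le> h} \<union> Pow \<sigma>"

text \<open>In the full simplex \<open>S\<close> leads the boundary of \<open>insert p S\<close>, a
  cycle that only involves \<open>h\<close>-sets and so survives in the skeleton. Faces of size
  \<open>h + 1\<close> lie in \<open>\<sigma>\<close>, so no boundary reaches a set outside
  \<open>\<sigma>\<close>.\<close>

lemma level_subset_critical:
  assumes p: "p \<in> \<sigma>" "\<sigma> \<subseteq> {1..m}"
  shows "{S. S \<subseteq> {1..m} - {p} \<and> card S = h} - Pow (\<sigma> - {p})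
    \<subseteq> critical TYPE('f::field) m p (skeleton_union_face m h \<sigma>)"
proof
  let ?K = "skeleton_union_face m h \<sigma>"
  fix S assume S: "S \<in> {S. S \<subseteq> {1..m} - {p} \<and> card S = h} - Pow (\<sigma> - {p})"
  have pm: "p \<in> {1..m}" using p by blast
  have "S \<in> ld m p (boundary_space m (Pow {1..m}) (card S) :: (nat set \<Rightarrow> 'f) set)"
    using S pm by (intro in_ld_boundary_space) auto
  moreover have "boundary_space m (Pow {1..m}) (card S)
      \<subseteq> (cycle_space m (Pow {1..m}) (card S) :: (nat set \<Rightarrow> 'f) set)"
    by (rule boundary_space_subset_cycle_space) auto
  moreover have "cycle_space m (Pow {1..m}) (card S)
      \<subseteq> (cycle_space m ?K (card S) :: (nat set \<Rightarrow> 'f) set)"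
    using S by (intro cycle_space_mono) (auto simp: skeleton_union_face_def)
  ultimately have cyc: "S \<in> ld m p (cycle_space m ?K (card S) :: (nat set \<Rightarrow> 'f) set)"
    using leads_mono by blast
  have "boundary_space m ?K (card S) \<subseteq> (boundary_space m (Pow \<sigma>) (card S) :: (nat set \<Rightarrow> 'f) set)"
    using S by (intro boundary_space_mono) (auto simp: skeleton_union_face_def)
  also have "\<dots> \<subseteq> cycle_space m (Pow \<sigma>) (card S)"
    using p(2) by (intro boundary_space_subset_cycle_space) auto
  also have "\<dots> \<subseteq> chain_space (Pow \<sigma>) (card S)" by (rule cycle_space_subset_chain_space)
  finally have "S \<notin> ld m p (boundary_space m ?K (card S) :: (nat set \<Rightarrow> 'f) set)"
    using ld_nonzero(1) S by blast
  then show "S \<in> critical TYPE('f) m p ?K" using cyc unfolding critical_def by blast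
qed

lemma complex_of_critical_level:
  assumes K: "simplicial_complex_on m K" and \<sigma>: "\<sigma> \<in> K" "p \<in> \<sigma>" and h: "0 < h" "h < m"
    and crit: "critical TYPE('f::field) m p K
      = {S. S \<subseteq> {1..m} - {p} \<and> card S = h} - Pow (\<sigma> - {p})"
  shows "K = skeleton_union_face m h \<sigma>"
proof -
  note Ks = simplicial_complexD[OF K]
  have \<sigma>m: "\<sigma> \<subseteq> {1..m}" using Ks(1) \<sigma>(1) by blast
  have pm: "p \<in> {1..m}" using \<sigma>m \<sigma>(2) by blast
  have low: "T \<in> ld m p (boundary_space m K (card T) :: (nat set \<Rightarrow> 'f) set)" if T: "T \<subseteq> \<sigma> - {p}" for T
  proof (rule in_ld_boundary_space[OF _ pm])
    show "T \<subseteq> {1..m} - {p}" using T \<sigma>m by blast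
    show "insert p T \<in> K" using T \<sigma>(2) by (intro Ks(4)[OF \<sigma>(1)]) blast
  qed
  \<comment> \<open>Every \<open>h\<close>-set avoiding \<open>p\<close> leads a cycle of
    \<open>K\<close>: inside \<open>\<sigma> - {p}\<close> by \<open>low\<close>, elsewhere because
    it is critical.\<close>
  have "ld m p (cycle_space m (Pow {1..m}) h :: (nat set \<Rightarrow> 'f) set)
    \<subseteq> ld m p (cycle_space m K h :: (nat set \<Rightarrow> 'f) set)"
  proof
    fix S assume "S \<in> ld m p (cycle_space m (Pow {1..m}) h :: (nat set \<Rightarrow> 'f) set)"
    then have S: "card S = h" "S \<subseteq> {1..m} - {p}"
      using ld_nonzero[OF _ cycle_space_subset_chain_space] by blast+
    show "S \<in> ld m p (cycle_space m K h :: (nat set \<Rightarrow> 'f) set)"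
    proof (cases "S \<subseteq> \<sigma> - {p}")
      case True
      then show ?thesis using low ld_boundary_subset_ld_cycle[OF K] S(1) by blast
    next
      case False
      then have "S \<in> critical TYPE('f) m p K" using crit S by blast
      then show ?thesis using S(1) unfolding critical_def by blast
    qed
  qed
  then have cyc: "cycle_space m (Pow {1..m}) h \<subseteq> (cycle_space m K h :: (nat set \<Rightarrow> 'f) set)"
  proof (rule subset_of_leads_subset[OF finite_Pow_vertices inj_on_set_encode_vertices
        lin_closed_cycle_space lin_closed_cycle_space, rotated 2])
    show "cycle_space m K h \<subseteq> (cycle_space m (Pow {1..m}) h :: (nat set \<Rightarrow> 'f) set)"
      using Ks(1) by (intro cycle_space_mono) auto
  qed (rule cycle_space_faithful[OF subset_refl pm])
  have level: "T \<in> K" if T: "T \<subseteq> {1..m}" "card T = h" for T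
  proof -
    \<comment> \<open>\<open>h < m\<close> leaves a vertex outside \<open>T\<close>. The boundary of
      \<open>insert u T\<close> is a cycle of the full simplex, hence supported on faces of
      \<open>K\<close>, and \<open>T\<close> is in its support.\<close>
    have "T \<noteq> {1..m}" using T(2) h(2) by auto
    then obtain u where u: "u \<in> {1..m}" "u \<notin> T" using T(1) by blast
    let ?y = "unit_chain (insert u T) :: nat set \<Rightarrow> 'f"
    have "finite T" using T(1) finite_subset by blast
    then have cT: "card (insert u T) = Suc h" using u T by simp
    have "?y \<in> chain_space (Pow {1..m}) (Suc h)"
      using unit_chain_in_chain_space[of "insert u T" "Pow {1..m}"] cT u T by simp
    then have "bdry m ?y \<in> boundary_space m (Pow {1..m}) h" unfolding boundary_space_def by (rule imageI)
    then have "bdry m ?y \<in> cycle_space m (Pow {1..m}) h"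
      using boundary_space_subset_cycle_space[of "Pow {1..m}" m h] by blast
    then have "bdry m ?y \<in> chain_space K h" using cyc cycle_space_subset_chain_space by blast
    moreover have "bdry m ?y (insert u T - {u}) \<noteq> 0" using u T by (intro bdry_unit_chain_facet) auto
    ultimately show ?thesis using chain_space_nonzeroD u by fastforce
  qed
  have skel: "T \<in> K" if T: "T \<subseteq> {1..m}" "card T \<le> h" for T
  proof -
    obtain R where "T \<subseteq> R" "R \<subseteq> {1..m}" "card R = h"
      using exists_subset_between[of T h "{1..m}"] T h(2) by auto
    then show ?thesis using level Ks(4) by blast
  qed
  \<comment> \<open>A lead of boundaries is not critical, so it lies in
    \<open>\<sigma> - {p}\<close>, where the cone over it inside \<open>\<sigma>\<close> already
    provides that lead.\<close>
  have "ld m p (boundary_space m K h :: (nat set \<Rightarrow> 'f) set)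
    \<subseteq> ld m p (boundary_space m (Pow \<sigma>) h :: (nat set \<Rightarrow> 'f) set)"
  proof
    fix S assume S: "S \<in> ld m p (boundary_space m K h :: (nat set \<Rightarrow> 'f) set)"
    then have "S \<in> ld m p (cycle_space m K h :: (nat set \<Rightarrow> 'f) set)"
      using ld_boundary_subset_ld_cycle[OF K] by blast
    then have Sh: "card S = h" "S \<subseteq> {1..m} - {p}"
      using ld_nonzero[OF _ cycle_space_subset_chain_space] by blast+
    have "S \<notin> critical TYPE('f) m p K" using S Sh(1) unfolding critical_def by blast
    then have "S \<subseteq> \<sigma> - {p}" using crit Sh by blast
    then show "S \<in> ld m p (boundary_space m (Pow \<sigma>) h :: (nat set \<Rightarrow> 'f) set)"
      using in_ld_boundary_space[OF Sh(2) pm, of "Pow \<sigma>"] Sh(1) \<sigma>(2) by blast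
  qed
  then have "boundary_space m K h \<subseteq> (boundary_space m (Pow \<sigma>) h :: (nat set \<Rightarrow> 'f) set)"
  proof (rule subset_of_leads_subset[OF finite_Pow_vertices inj_on_set_encode_vertices
        lin_closed_boundary_space lin_closed_boundary_space, rotated 2])
    show "boundary_space m (Pow \<sigma>) h \<subseteq> (boundary_space m K h :: (nat set \<Rightarrow> 'f) set)"
      using Ks(4)[OF \<sigma>(1)] by (intro boundary_space_mono) auto
    fix z :: "nat set \<Rightarrow> 'f" assume z: "z \<in> boundary_space m K h" "\<forall>S\<in>Pow ({1..m} - {p}). z S = 0"
    have "boundary_space m K h \<subseteq> (cycle_space m K h :: (nat set \<Rightarrow> 'f) set)"
      using Ks(1) Ks(4) by (rule boundary_space_subset_cycle_space)
    then have "z \<in> cycle_space m K h" using z(1) by blast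
    then show "z = (\<lambda>S. 0)" using z(2) by (rule cycle_space_faithful[OF Ks(1) pm])
  qed
  also have "\<dots> \<subseteq> cycle_space m (Pow \<sigma>) h"
    using \<sigma>m by (intro boundary_space_subset_cycle_space) auto
  also have "\<dots> \<subseteq> chain_space (Pow \<sigma>) h" by (rule cycle_space_subset_chain_space)
  finally have bds: "boundary_space m K h \<subseteq> (chain_space (Pow \<sigma>) h :: (nat set \<Rightarrow> 'f) set)" .
  have top: "\<tau> \<subseteq> \<sigma>" if \<tau>: "\<tau> \<in> K" "card \<tau> = Suc h" for \<tau>
  proof
    fix x assume x: "x \<in> \<tau>"
    \<comment> \<open>\<open>h > 0\<close> gives \<open>\<tau>\<close> a second vertex
      \<open>v\<close>, so \<open>x\<close> stays in the facet \<open>\<tau> - {v}\<close>, which is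
      in the support of a boundary and hence inside \<open>\<sigma>\<close>.\<close>
    have "card (\<tau> - {x}) \<noteq> 0" using x \<tau>(2) h(1) by simp
    then obtain v where v: "v \<in> \<tau>" "v \<noteq> x" by (metis card.empty all_not_in_conv Diff_iff singletonI)
    let ?y = "unit_chain \<tau> :: nat set \<Rightarrow> 'f"
    have "?y \<in> chain_space K (Suc h)" using unit_chain_in_chain_space[OF \<tau>(1)] \<tau>(2) by metis
    then have "bdry m ?y \<in> chain_space (Pow \<sigma>) h" using bds unfolding boundary_space_def by blast
    moreover have "bdry m ?y (\<tau> - {v}) \<noteq> 0" using Ks(1) \<tau>(1) v(1) by (intro bdry_unit_chain_facet) auto
    ultimately have "\<tau> - {v} \<subseteq> \<sigma>" using chain_space_nonzeroD by blast
    then show "x \<in> \<sigma>" using x v by blast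
  qed
  have large: "\<tau> \<subseteq> \<sigma>" if \<tau>: "\<tau> \<in> K" "\<not> card \<tau> \<le> h" for \<tau>
  proof
    fix x assume x: "x \<in> \<tau>"
    obtain R where R: "{x} \<subseteq> R" "R \<subseteq> \<tau>" "card R = Suc h"
      using exists_subset_between[of "{x}" "Suc h" \<tau>] x \<tau>(2) Ks(5)[OF \<tau>(1)] by auto
    then show "x \<in> \<sigma>" using top[of R] Ks(4)[OF \<tau>(1)] by blast
  qed
  show ?thesis
  proof (rule equalityI; rule subsetI)
    fix \<tau> assume "\<tau> \<in> K"
    then show "\<tau> \<in> skeleton_union_face m h \<sigma>"
      using large[of \<tau>] Ks(1) unfolding skeleton_union_face_def by auto
  next
    fix \<tau> assume "\<tau> \<in> skeleton_union_face m h \<sigma>"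
    then show "\<tau> \<in> K"
      using skel[of \<tau>] Ks(4)[OF \<sigma>(1), of \<tau>] unfolding skeleton_union_face_def by auto
  qed
qed

section \<open>Complexes of maximal total Betti number\<close>

text \<open>For \<open>d + 1 \<le> m div 2\<close> the dimension already keeps all critical sets at
  size at most \<open>h\<close>. Otherwise \<open>h = m div 2\<close> satisfies
  \<open>m - 1 \<le> 2 * h \<le> m\<close>, and larger sets have to be compressed as well.\<close>

lemma critical_bound:
  assumes K: "simplicial_complex_on m K" "complex_dim K = int d" and dm: "d + 1 < m"
    and \<sigma>: "\<sigma> \<in> K" "card \<sigma> = d + 1" "p \<in> \<sigma>"
    and h: "h = min (d + 1) (m div 2)"
  defines "C \<equiv> critical TYPE('f::field) m p K"
  shows "card C + (d choose h) \<le> (m - 1) choose h"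
    and "card C + (d choose h) = (m - 1) choose h \<Longrightarrow>
      C = {S. S \<subseteq> {1..m} - {p} \<and> card S = h} - Pow (\<sigma> - {p}) \<or>
      m = 2 * h + 1 \<and> m = d + 2 \<and>
        C = {S. S \<subseteq> {1..m} - {p} \<and> card S = h + 1} - Pow (\<sigma> - {p})"
proof -
  let ?X = "{1..m} - {p}" and ?D = "\<sigma> - {p}"
  note Ks = simplicial_complexD[OF K(1)]
  have \<sigma>m: "\<sigma> \<subseteq> {1..m}" using Ks(1) \<sigma>(1) by blast
  have X: "finite ?X" "card ?X = m - 1" using \<sigma>m \<sigma>(3) by auto
  have D: "?D \<subseteq> ?X" "card ?D = d" using \<sigma>m \<sigma> Ks(5)[OF \<sigma>(1)] by auto
  have C: "C \<subseteq> Pow ?X - Pow ?D" unfolding C_def by (rule critical_avoids_face[OF K(1) \<sigma>(1,3)])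
  have anti: "antichain C"
    unfolding antichain_def C_def using critical_incomparable[OF K(1)] by blast
  have size: "card S \<le> d + 1" if "S \<in> C" for S
    using critical_memD(1) that K complex_dim_iff unfolding C_def by blast
  have *: "card C + (d choose h) \<le> (m - 1) choose h \<and>
    (card C + (d choose h) = (m - 1) choose h \<longrightarrow>
      C = {S. S \<subseteq> ?X \<and> card S = h} - Pow ?D \<or>
      m = 2 * h + 1 \<and> m = d + 2 \<and> C = {S. S \<subseteq> ?X \<and> card S = h + 1} - Pow ?D)"
  proof (cases "d + 1 \<le> m div 2")
    case True
    then have hd: "h = d + 1" using h by simp
    have "2 * h \<le> card ?X + 1" "0 < h" "h \<le> card ?D + 1"
      unfolding X(2) D(2) hd using True dm by auto
    moreover have "card S \<le> h" if "S \<in> C" for S using size[OF that] hd by simp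
    ultimately show ?thesis
      using sperner_avoiding_lower[OF X(1) D(1) C anti, of h] unfolding X(2) D(2) by blast
  next
    case False
    then have hm: "h = m div 2" using h by simp
    have "2 * h \<le> card ?X + 1" "card ?X \<le> 2 * h" "0 < h" "h \<le> card ?D + 1" "h \<le> d + 1"
      unfolding X(2) D(2) hm using False dm by auto
    note upper = sperner_avoiding_upper[OF X(1) D(1) C anti size this]
    have "m - 1 = 2 * h \<longleftrightarrow> m = 2 * h + 1" "m - 1 = d + 1 \<longleftrightarrow> m = d + 2"
      using dm by auto
    with upper show ?thesis unfolding X(2) D(2) by simp
  qed
  show "card C + (d choose h) \<le> (m - 1) choose h" by (rule conjunct1[OF *])
  show "C = {S. S \<subseteq> ?X \<and> card S = h} - Pow ?D \<or>
      m = 2 * h + 1 \<and> m = d + 2 \<and> C = {S. S \<subseteq> ?X \<and> card S = h + 1} - Pow ?D"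
    if "card C + (d choose h) = (m - 1) choose h"
    using conjunct2[OF *] that by (rule mp)
qed

section \<open>Attaining the bound\<close>

lemma skeleton_union_face_in_Sigma:
  assumes \<sigma>: "\<sigma> \<subseteq> {1..m}" "card \<sigma> = d + 1" and h: "0 < h" "h \<le> d + 1"
  shows "skeleton_union_face m h \<sigma> \<in> Sigma_complexes m d"
proof -
  let ?K = "skeleton_union_face m h \<sigma>"
  have mono: "card \<tau> \<le> card \<rho>" if "\<tau> \<subseteq> \<rho>" "\<rho> \<subseteq> {1..m}" for \<tau> \<rho>
    using that finite_subset[of \<rho> "{1..m}"] by (intro card_mono) auto
  have K: "simplicial_complex_on m ?K"
    unfolding simplicial_complex_on_def
  proof (intro conjI ballI allI impI)
    fix \<rho> \<tau> assume "\<rho> \<in> ?K" "\<tau> \<subseteq> \<rho>"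
    then show "\<tau> \<in> ?K"
      using mono[of \<tau> \<rho>] unfolding skeleton_union_face_def by auto
  qed (use \<sigma> h in \<open>auto simp: skeleton_union_face_def\<close>)
  have "card \<tau> \<le> d + 1" if "\<tau> \<in> ?K" for \<tau>
    using that mono[OF _ \<sigma>(1)] \<sigma>(2) h unfolding skeleton_union_face_def by fastforce
  moreover have "\<sigma> \<in> ?K" unfolding skeleton_union_face_def by blast
  ultimately have "complex_dim ?K = int d" unfolding complex_dim_iff[OF K] using \<sigma>(2) by blast
  then show ?thesis using K unfolding Sigma_complexes_def by blast
qed

text \<open>Only a lower bound is needed here: for the extremal levels the general upper bound
  supplies the other direction.\<close>

lemma total_reduced_betti_skeleton_union_face:
  assumes \<sigma>: "\<sigma> \<subseteq> {1..m}" "card \<sigma> = d + 1" and h: "0 < h" "h \<le> d + 1"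
  shows "(m - 1) choose h \<le> total_reduced_betti TYPE('f::field) (skeleton_union_face m h \<sigma>) + (d choose h)"
proof -
  let ?K = "skeleton_union_face m h \<sigma>"
  have K: "simplicial_complex_on m ?K" "complex_dim ?K = int d"
    using skeleton_union_face_in_Sigma[OF \<sigma> h] unfolding Sigma_complexes_def by auto
  have "\<sigma> \<noteq> {}" using \<sigma>(2) by auto
  then obtain p where p: "p \<in> \<sigma>" by blast
  have pm: "p \<in> {1..m}" using p \<sigma>(1) by blast
  let ?X = "{1..m} - {p}" and ?D = "\<sigma> - {p}" and ?C = "critical TYPE('f) m p ?K"
  have fin: "finite \<sigma>" using \<sigma>(1) finite_subset by blast
  have D: "card ?D = d" using \<sigma>(2) p fin by simp
  have finC: "finite ?C" using critical_memD(1) simplicial_complexD(6)[OF K(1)] by (metis finite_subset subsetI)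
  have "{S. S \<subseteq> ?X \<and> card S = h} \<subseteq> ?C \<union> {S. S \<subseteq> ?D \<and> card S = h}"
    using level_subset_critical[OF p \<sigma>(1), where 'f = 'f] by blast
  then have "card {S. S \<subseteq> ?X \<and> card S = h} \<le> card (?C \<union> {S. S \<subseteq> ?D \<and> card S = h})"
    using finC fin by (intro card_mono) auto
  also have "\<dots> \<le> card ?C + card {S. S \<subseteq> ?D \<and> card S = h}" by (rule card_Un_le)
  finally show ?thesis
    using n_subsets[of ?X h] n_subsets[of ?D h] fin D pm
    by (simp add: total_reduced_betti_eq_card_critical[OF K(1) pm K(2)])
qed

lemma Sigma_tb_eq:
  assumes dm: "d + 1 < m" and h: "h = min (d + 1) (m div 2)"
  shows "Sigma_tb TYPE('f::field) m d =
    {skeleton_union_face m h \<sigma> | \<sigma>. \<sigma> \<subseteq> {1..m} \<and> card \<sigma> = d + 1} \<union>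
    (if m = 2 * h + 1 \<and> m = d + 2
     then {skeleton_union_face m (h + 1) \<sigma> | \<sigma>. \<sigma> \<subseteq> {1..m} \<and> card \<sigma> = d + 1} else {})"
    (is "_ = ?R")
proof -
  let ?tb = "total_reduced_betti TYPE('f)"
  \<comment> \<open>The number of \<open>h\<close>-subsets of \<open>m - 1\<close> points that are
    not contained in a given \<open>d\<close>-subset.\<close>
  define M where "M = ((m - 1) choose h) - (d choose h)"
  have h0: "0 < h" "h < m" "h \<le> d + 1" using h dm by auto
  have *: "?tb K \<le> M \<and> (?tb K = M \<longrightarrow> K \<in> ?R)" if "K \<in> Sigma_complexes m d" for K
  proof -
    have K: "simplicial_complex_on m K" "complex_dim K = int d"
      using that unfolding Sigma_complexes_def by auto
    obtain \<sigma> where \<sigma>: "\<sigma> \<in> K" "card \<sigma> = d + 1" using K complex_dim_iff by blast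
    have "\<sigma> \<noteq> {}" using \<sigma>(2) by auto
    then obtain p where p: "p \<in> \<sigma>" by blast
    have \<sigma>m: "\<sigma> \<subseteq> {1..m}" using simplicial_complexD(1)[OF K(1)] \<sigma>(1) by blast
    have tb: "?tb K = card (critical TYPE('f) m p K)"
      using p \<sigma>m by (intro total_reduced_betti_eq_card_critical[OF K(1) _ K(2)]) auto
    note bound = critical_bound[OF K dm \<sigma> p h, where 'f = 'f, folded tb]
    have "K \<in> ?R" if "?tb K = M"
    proof -
      have "?tb K + (d choose h) = (m - 1) choose h" using that bound(1) unfolding M_def by linarith
      from bound(2)[OF this] show ?thesis
      proof (elim disjE conjE)
        assume "critical TYPE('f) m p K
          = {S. S \<subseteq> {1..m} - {p} \<and> card S = h} - Pow (\<sigma> - {p})"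
        from complex_of_critical_level[OF K(1) \<sigma>(1) p h0(1,2) this] show ?thesis
          using \<sigma>m \<sigma>(2) by blast
      next
        assume m: "m = 2 * h + 1" "m = d + 2" and "critical TYPE('f) m p K
          = {S. S \<subseteq> {1..m} - {p} \<and> card S = h + 1} - Pow (\<sigma> - {p})"
        from complex_of_critical_level[OF K(1) \<sigma>(1) p _ _ this(3)] have "K = skeleton_union_face m (h + 1) \<sigma>"
          using m h0 by simp
        then show ?thesis using \<sigma>m \<sigma>(2) m by auto
      qed
    qed
    then show ?thesis using bound(1) unfolding M_def by linarith
  qed
  have R: "K \<in> Sigma_complexes m d \<and> ?tb K = M" if "K \<in> ?R" for K
  proof -
    have "K \<in> Sigma_complexes m d \<and> M \<le> ?tb K"
    proof (cases "K \<in> {skeleton_union_face m h \<sigma> | \<sigma>. \<sigma> \<subseteq> {1..m} \<and> card \<sigma> = d + 1}")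
      case True
      then obtain \<sigma> where \<sigma>: "\<sigma> \<subseteq> {1..m}" "card \<sigma> = d + 1" "K = skeleton_union_face m h \<sigma>" by blast
      then show ?thesis
        using skeleton_union_face_in_Sigma[OF \<sigma>(1,2) h0(1,3)]
          total_reduced_betti_skeleton_union_face[OF \<sigma>(1,2) h0(1,3), where 'f = 'f]
        unfolding M_def by simp
    next
      case False
      with that have m: "m = 2 * h + 1" "m = d + 2"
        and "K \<in> {skeleton_union_face m (h + 1) \<sigma> | \<sigma>. \<sigma> \<subseteq> {1..m} \<and> card \<sigma> = d + 1}"
        by (auto split: if_splits)
      then obtain \<sigma> where \<sigma>: "\<sigma> \<subseteq> {1..m}" "card \<sigma> = d + 1" "K = skeleton_union_face m (h + 1) \<sigma>"
        by blast
      have h1: "0 < h + 1" "h + 1 \<le> d + 1" using m h0 by auto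
      obtain k where k: "h = Suc k" using h0(1) gr0_implies_Suc by blast
      \<comment> \<open>Here \<open>d = 2 * h - 1\<close>, so \<open>k = h - 1\<close> and
        \<open>h\<close> are complementary in \<open>d\<close>. With Pascal's rule this makes levels
        \<open>h\<close> and \<open>h + 1\<close> leave equally many sets outside the forbidden
        \<open>d\<close>-set.\<close>
      have "d choose k = d choose h"
        using binomial_symmetric[of k d] m k by simp
      then have "((m - 1) choose (h + 1)) + (d choose h) = ((m - 1) choose h) + (d choose (h + 1))"
        using m k by simp
      then show ?thesis
        using skeleton_union_face_in_Sigma[OF \<sigma>(1,2) h1] \<sigma>(3)
          total_reduced_betti_skeleton_union_face[OF \<sigma>(1,2) h1, where 'f = 'f]
        unfolding M_def by simp
    qed
    then show ?thesis using * by force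
  qed
  have "Sigma_complexes m d \<subseteq> Pow (Pow {1..m})"
    using simplicial_complexD(1) by (auto simp: Sigma_complexes_def)
  then have fin: "finite (Sigma_complexes m d)" by (rule finite_subset) simp
  \<comment> \<open>A single member of the first family shows that the value \<open>M\<close> is
    attained.\<close>
  have "card {1..d + 1} = d + 1" "{1..d + 1} \<subseteq> {1..m}" using dm by auto
  then have "skeleton_union_face m h {1..d + 1} \<in> ?R" by blast
  from R[OF this] have "Max (?tb ` Sigma_complexes m d) = M"
    using fin * by (intro Max_eqI) auto
  then show ?thesis unfolding Sigma_tb_def using * R by blast
qed

section \<open>Isomorphic copies of the extremal complexes\<close>

lemma skeleton_with_simplex_eq:
  "d < m \<Longrightarrow> skeleton_with_simplex m k d = skeleton_union_face m (k + 1) {1..d + 1}"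
  unfolding skeleton_with_simplex_def full_skeleton_def skeleton_union_face_def by auto

lemma full_skeleton_eq:
  assumes "d < m"
  shows "full_skeleton m d = skeleton_with_simplex m d d"
proof -
  have "\<tau> \<subseteq> {1..m} \<and> card \<tau> \<le> d + 1" if "\<tau> \<subseteq> {1..d + 1}" for \<tau>
    using that assms card_mono[of "{1..d + 1}" \<tau>] by auto
  then show ?thesis unfolding skeleton_with_simplex_def full_skeleton_def by blast
qed

lemma image_skeleton_union_face:
  assumes \<phi>: "bij_betw \<phi> {1..m} {1..m}" and \<sigma>: "\<sigma> \<subseteq> {1..m}"
  shows "(\<lambda>\<tau>. \<phi> ` \<tau>) ` skeleton_union_face m h \<sigma> = skeleton_union_face m h (\<phi> ` \<sigma>)"
proof -
  have inj: "inj_on \<phi> {1..m}" and im: "\<phi> ` {1..m} = {1..m}" using \<phi> by (auto simp: bij_betw_def)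
  have c: "card (\<phi> ` \<tau>) = card \<tau>" if "\<tau> \<subseteq> {1..m}" for \<tau>
    using inj_on_subset[OF inj that] by (rule card_image)
  have "(\<lambda>\<tau>. \<phi> ` \<tau>) ` {\<tau>. \<tau> \<subseteq> {1..m} \<and> card \<tau> \<le> h} = {\<tau>. \<tau> \<subseteq> {1..m} \<and> card \<tau> \<le> h}"
  proof (rule equalityI; rule subsetI)
    fix \<tau> assume "\<tau> \<in> (\<lambda>\<tau>. \<phi> ` \<tau>) ` {\<tau>. \<tau> \<subseteq> {1..m} \<and> card \<tau> \<le> h}"
    then show "\<tau> \<in> {\<tau>. \<tau> \<subseteq> {1..m} \<and> card \<tau> \<le> h}" using c im by auto
  next
    fix \<tau> assume \<tau>: "\<tau> \<in> {\<tau>. \<tau> \<subseteq> {1..m} \<and> card \<tau> \<le> h}"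
    then have "\<tau> \<subseteq> \<phi> ` {1..m}" using im by simp
    then obtain \<rho> where \<rho>: "\<rho> \<subseteq> {1..m}" "\<tau> = \<phi> ` \<rho>" by (rule subset_imageE)
    then have "card \<rho> \<le> h" using \<tau> c by simp
    with \<rho> show "\<tau> \<in> (\<lambda>\<tau>. \<phi> ` \<tau>) ` {\<tau>. \<tau> \<subseteq> {1..m} \<and> card \<tau> \<le> h}" by simp
  qed
  moreover have "(\<lambda>\<tau>. \<phi> ` \<tau>) ` Pow \<sigma> = Pow (\<phi> ` \<sigma>)" by (rule image_Pow_surj) simp
  ultimately show ?thesis unfolding skeleton_union_face_def image_Un by simp
qed

lemma Union_simplicial_complex:
  assumes "simplicial_complex_on m K"
  shows "\<Union>K = {1..m}"
  using simplicial_complexD(1,3)[OF assms] by blast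

text \<open>The skeleton is invariant under permutations of the vertices, so a copy is determined by
  the preimage of the standard simplex, and every \<open>(d + 1)\<close>-set occurs as such a
  preimage.\<close>

lemma iso_copies_skeleton_with_simplex:
  assumes dm: "d < m" and k: "k \<le> d"
  shows "iso_copies m {skeleton_with_simplex m k d} =
    {skeleton_union_face m (k + 1) \<sigma> | \<sigma>. \<sigma> \<subseteq> {1..m} \<and> card \<sigma> = d + 1}"
proof -
  let ?s = "{1..d + 1}"
  let ?L = "skeleton_union_face m (k + 1) ?s"
  have s: "?s \<subseteq> {1..m}" "card ?s = d + 1" using dm by auto
  have complex: "simplicial_complex_on m (skeleton_union_face m (k + 1) \<sigma>)"
    if "\<sigma> \<subseteq> {1..m}" "card \<sigma> = d + 1" for \<sigma>
    using skeleton_union_face_in_Sigma[OF that, of "k + 1"] k unfolding Sigma_complexes_def by simp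
  note UL = Union_simplicial_complex[OF complex[OF s]]
  show ?thesis
    unfolding skeleton_with_simplex_eq[OF dm] iso_copies_def
  proof (rule equalityI; rule subsetI)
    fix K assume "K \<in> {K. simplicial_complex_on m K \<and> (\<exists>L\<in>{?L}. simplicial_iso K L)}"
    then have K: "simplicial_complex_on m K" and "simplicial_iso K ?L" by auto
    then obtain \<phi> where \<phi>: "bij_betw \<phi> {1..m} {1..m}" "(\<lambda>\<tau>. \<phi> ` \<tau>) ` K = ?L"
      unfolding simplicial_iso_def UL Union_simplicial_complex[OF K] by blast
    have inj: "inj_on \<phi> {1..m}" and im: "\<phi> ` {1..m} = {1..m}" using \<phi>(1) by (auto simp: bij_betw_def)
    obtain \<sigma> where \<sigma>: "\<sigma> \<subseteq> {1..m}" "?s = \<phi> ` \<sigma>" using s(1) im by (metis subset_image_iff)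
    have "card \<sigma> = d + 1" using card_image[OF inj_on_subset[OF inj \<sigma>(1)]] \<sigma>(2) s(2) by simp
    \<comment> \<open>Taking images under \<open>\<phi>\<close> is injective on subsets of
      \<open>{1..m}\<close>, so equality of the two image families will identify the
      complexes.\<close>
    moreover have "(\<lambda>\<tau>. \<phi> ` \<tau>) ` skeleton_union_face m (k + 1) \<sigma> = (\<lambda>\<tau>. \<phi> ` \<tau>) ` K"
      using image_skeleton_union_face[OF \<phi>(1) \<sigma>(1)] \<phi>(2) \<sigma>(2) by simp
    then have "skeleton_union_face m (k + 1) \<sigma> = K"
      using simplicial_complexD(1)[OF K] simplicial_complexD(1)[OF complex[OF \<sigma>(1) calculation]]
      by (simp add: inj_on_image_eq_iff[OF inj_on_image_Pow[OF inj]])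
    ultimately show "K \<in> {skeleton_union_face m (k + 1) \<sigma> | \<sigma>. \<sigma> \<subseteq> {1..m} \<and> card \<sigma> = d + 1}"
      using \<sigma>(1) by blast
  next
    fix K assume "K \<in> {skeleton_union_face m (k + 1) \<sigma> | \<sigma>. \<sigma> \<subseteq> {1..m} \<and> card \<sigma> = d + 1}"
    then obtain \<sigma> where \<sigma>: "\<sigma> \<subseteq> {1..m}" "card \<sigma> = d + 1" and Keq: "K = skeleton_union_face m (k + 1) \<sigma>"
      by blast
    have K: "simplicial_complex_on m K" unfolding Keq by (rule complex[OF \<sigma>])
    have fin: "finite \<sigma>" using \<sigma>(1) finite_subset by blast
    obtain f where f: "bij_betw f \<sigma> ?s"
      using finite_same_card_bij[OF fin, of ?s] \<sigma>(2) s(2) by auto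
    have "card ({1..m} - \<sigma>) = card ({1..m} - ?s)"
      using \<sigma> s fin by (simp add: card_Diff_subset)
    then obtain g where g: "bij_betw g ({1..m} - \<sigma>) ({1..m} - ?s)"
      using finite_same_card_bij[of "{1..m} - \<sigma>" "{1..m} - ?s"] by auto
    \<comment> \<open>Bijections of \<open>\<sigma>\<close> and of its complement are glued into a
      permutation of all vertices.\<close>
    define \<phi> where "\<phi> x = (if x \<in> \<sigma> then f x else g x)" for x
    have f': "bij_betw \<phi> \<sigma> ?s" using f by (rule bij_betw_cong[THEN iffD1, rotated]) (simp add: \<phi>_def)
    have g': "bij_betw \<phi> ({1..m} - \<sigma>) ({1..m} - ?s)"
      using g by (rule bij_betw_cong[THEN iffD1, rotated]) (simp add: \<phi>_def)
    have "bij_betw \<phi> (\<sigma> \<union> ({1..m} - \<sigma>)) (?s \<union> ({1..m} - ?s))"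
      using f' g' by (rule bij_betw_combine) blast
    then have \<phi>: "bij_betw \<phi> {1..m} {1..m}" using \<sigma>(1) s(1) by (simp add: Un_absorb1)
    have "\<phi> ` \<sigma> = ?s" using f' by (simp add: bij_betw_def)
    then have "(\<lambda>\<tau>. \<phi> ` \<tau>) ` K = ?L" unfolding Keq using image_skeleton_union_face[OF \<phi> \<sigma>(1)] by simp
    then have "simplicial_iso K ?L"
      unfolding simplicial_iso_def UL Union_simplicial_complex[OF K] using \<phi> by blast
    then show "K \<in> {K. simplicial_complex_on m K \<and> (\<exists>L\<in>{?L}. simplicial_iso K L)}" using K by blast
  qed
qed

lemma iso_copies_pair: "iso_copies m {L, L'} = iso_copies m {L} \<union> iso_copies m {L'}"
  unfolding iso_copies_def by blast

text \<open>This covers \<open>d = m - 1\<close>, where no vertex lies outside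
  \<open>\<sigma>\<close> and \<open>Sigma_tb_eq\<close> does not apply.\<close>

lemma Sigma_complexes_full_dimension:
  assumes m: "m = d + 1"
  shows "Sigma_complexes m d = {Pow {1..m}}"
proof (rule equalityI; rule subsetI)
  fix K assume "K \<in> Sigma_complexes m d"
  then have K: "simplicial_complex_on m K" "complex_dim K = int d"
    unfolding Sigma_complexes_def by auto
  obtain \<sigma> where \<sigma>: "\<sigma> \<in> K" "card \<sigma> = m" using K complex_dim_iff m by blast
  have "\<sigma> = {1..m}"
    using simplicial_complexD(1)[OF K(1)] \<sigma> by (intro card_subset_eq) auto
  then show "K \<in> {Pow {1..m}}"
    using simplicial_complexD(1,4)[OF K(1)] \<sigma>(1) by blast
next
  fix K assume "K \<in> {Pow {1..m}}"
  moreover have "skeleton_union_face m m {1..m} = Pow {1..m}"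
    unfolding skeleton_union_face_def by auto
  ultimately show "K \<in> Sigma_complexes m d"
    using skeleton_union_face_in_Sigma[of "{1..m}" m d m] m by simp
qed

theorem theorem1p2:
  fixes m d :: nat
  assumes "d < m"
  shows
    "(int d \<le> int (m div 2) - 1 \<or> d = m - 1 \<longrightarrow>
        Sigma_tb TYPE('f::field) m d = iso_copies m {full_skeleton m d}) \<and>
     (m div 2 \<le> d \<and> int d \<le> int m - 3 \<longrightarrow>
        Sigma_tb TYPE('f) m d = iso_copies m {skeleton_with_simplex m (m div 2 - 1) d}) \<and>
     (int d = int m - 2 \<longrightarrow>
        (odd m \<longrightarrow> Sigma_tb TYPE('f) m d =
           iso_copies m {skeleton_with_simplex m (m div 2 - 1) d,
                         skeleton_with_simplex m (m div 2) d}) \<and>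
        (even m \<longrightarrow> Sigma_tb TYPE('f) m d =
           iso_copies m {skeleton_with_simplex m (m div 2 - 1) d}))"
proof (intro conjI impI)
  assume low: "int d \<le> int (m div 2) - 1 \<or> d = m - 1"
  have copies: "iso_copies m {full_skeleton m d} =
      {skeleton_union_face m (d + 1) \<sigma> | \<sigma>. \<sigma> \<subseteq> {1..m} \<and> card \<sigma> = d + 1}"
    unfolding full_skeleton_eq[OF assms] by (rule iso_copies_skeleton_with_simplex[OF assms]) simp
  show "Sigma_tb TYPE('f) m d = iso_copies m {full_skeleton m d}"
  proof (cases "m = d + 1")
    case True
    have "\<sigma> = {1..m}" if "\<sigma> \<subseteq> {1..m}" "card \<sigma> = d + 1" for \<sigma>
      using that True by (intro card_subset_eq) auto
    moreover have "skeleton_union_face m (d + 1) {1..m} = Pow {1..m}"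
      using card_mono[of "{1..m}"] True unfolding skeleton_union_face_def by auto
    moreover have "card {1..m} = d + 1" using True by simp
    ultimately have "{skeleton_union_face m (d + 1) \<sigma> | \<sigma>. \<sigma> \<subseteq> {1..m} \<and> card \<sigma> = d + 1} = {Pow {1..m}}"
      by blast
    moreover have "Sigma_tb TYPE('f) m d = {Pow {1..m}}"
      unfolding Sigma_tb_def Sigma_complexes_full_dimension[OF True] by auto
    ultimately show ?thesis unfolding copies by simp
  next
    case False
    \<comment> \<open>With \<open>m\<close> different from \<open>d + 1\<close>, the first
      alternative of \<open>low\<close> must hold, and it says
      \<open>d + 1 \<le> m div 2\<close>.\<close>
    then have "d + 1 < m" "d + 1 = min (d + 1) (m div 2)" using low assms by auto
    note tb = Sigma_tb_eq[OF this, where 'f = 'f]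
    \<comment> \<open>Both equations together would force \<open>d + 1 = 0\<close>.\<close>
    have no_extra: "\<not> (m = 2 * (d + 1) + 1 \<and> m = d + 2)" by auto
    show ?thesis unfolding copies tb if_not_P[OF no_extra] by (rule Un_empty_right)
  qed
next
  assume d: "m div 2 \<le> d \<and> int d \<le> int m - 3"
  \<comment> \<open>\<open>m \<ge> d + 3\<close> rules out the exceptional family and gives
    \<open>m div 2 \<ge> 1\<close>, so the truncated \<open>m div 2 - 1\<close> can be
    undone.\<close>
  then have *: "d + 1 < m" "m div 2 = min (d + 1) (m div 2)" and m: "m \<noteq> d + 2"
      and k: "m div 2 - 1 \<le> d" "m div 2 - 1 + 1 = m div 2"
    by auto
  show "Sigma_tb TYPE('f) m d = iso_copies m {skeleton_with_simplex m (m div 2 - 1) d}"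
    unfolding iso_copies_skeleton_with_simplex[OF assms k(1)] k(2) Sigma_tb_eq[OF *, where 'f = 'f]
    using m by simp
next
  assume "int d = int m - 2"
  then have m: "m = d + 2" by simp
  then have *: "d + 1 < m" "m div 2 = min (d + 1) (m div 2)"
    and k: "m div 2 - 1 \<le> d" "m div 2 - 1 + 1 = m div 2" by auto
  note tb = Sigma_tb_eq[OF *, where 'f = 'f]
  have low: "iso_copies m {skeleton_with_simplex m (m div 2 - 1) d} =
      {skeleton_union_face m (m div 2) \<sigma> | \<sigma>. \<sigma> \<subseteq> {1..m} \<and> card \<sigma> = d + 1}"
    unfolding iso_copies_skeleton_with_simplex[OF assms k(1)] k(2) by (rule refl)
  {
    assume odd: "odd m"
    \<comment> \<open>Both conditions of the exceptional family hold with
      \<open>h = m div 2\<close>; its bound \<open>h + 1\<close> on sizes means a skeleton of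
      dimension \<open>m div 2\<close>.\<close>
    then have m2: "m = 2 * (m div 2) + 1" by simp
    then have md: "m div 2 \<le> d" using m by linarith
    show "Sigma_tb TYPE('f) m d =
        iso_copies m {skeleton_with_simplex m (m div 2 - 1) d, skeleton_with_simplex m (m div 2) d}"
      unfolding iso_copies_pair low iso_copies_skeleton_with_simplex[OF assms md]
        tb if_P[OF conjI[OF m2 m]] by (rule refl)
  next
    assume even: "even m"
    then have no_extra: "\<not> (m = 2 * (m div 2) + 1 \<and> m = d + 2)" by simp
    show "Sigma_tb TYPE('f) m d = iso_copies m {skeleton_with_simplex m (m div 2 - 1) d}"
      unfolding low tb if_not_P[OF no_extra] by (rule Un_empty_right)
  }
qed

end
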